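(* Let $K$ be an algebraically closed field. With the list of representatives of the $\mathrm{GL}_3(K)$-orbits in $\mathcal{N}_{3,2}$ given in the context, the minimal degenerations (the edges of the Hasse diagram of the degeneration order) among the $\mathrm{GL}_3(K)$-orbits in $\mathcal{N}_{3,2}$ are exactly the following: \begin{itemize} \item for all $\lambda,\mu\in K$ with $\mu\ne 0$: the minimal degenerations of $\mathcal{O}(A_{\lambda,\mu})$ are $\mathcal{O}(C)$ and $\mathcal{O}(D)$; \item for all $\lambda\in K$: the minimal degenerations of $\mathcal{O}(A_{\lambda,\infty})$ are $\mathcal{O}(C)$ and $\mathcal{O}(D)$; \item for all $\lambda\in K$: the minimal degenerations of $\mathcal{O}(A_{\infty,\lambda})$ are $\mathcal{O}(C)$ and $\mathcal{O}(D)$; \item for all $\rho,\lambda\in K$: the only minimal degeneration of $\mathcal{O}(B_{\rho,\lambda})$ is $\mathcal{O}(E_\rho)$; \item for all $\lambda\in K$: the only minimal degeneration of $\mathcal{O}(B_{\infty,\lambda})$ is $\mathcal{O}(E_\infty)$; \item the minimal degenerations of $\mathcal{O}(C)$ are $\mathcal{O}(E_\infty)$ and $\mathcal{O}(E_\rho)$ for all $\rho\in K$; \item the minimal degenerations of $\mathcal{O}(D)$ are $\mathcal{O}(E_\infty)$ and $\mathcal{O}(E_\rho)$ for all $\rho\in K$; \item for all $\rho\in K\cup\{\infty\}$: the only minimal degeneration of $\mathcal{O}(E_\rho)$ is $\mathcal{O}(O)$; \item $\mathcal{O}(O)$ has no proper degeneration. \end{itemize} The degeneration order is the reflexive and transitive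 closure of these relations.
   Context: $E_{ij}$ denotes the $3\times 3$ matrix unit with entry $1$ in position $(i,j)$ and $0$ elsewhere. $\mathrm{GL}_3(K)$ acts on $(K^{3\times 3})^2$ by simultaneous conjugation, $g\cdot(A_1,A_2)=(gA_1g^{-1},gA_2g^{-1})$; $\mathcal{O}(A)$ is the orbit of $A$ and $\overline{\mathcal{O}(A)}$ its Zariski closure. $\mathcal{N}_{3,2}$ is the set of pairs $(A_1,A_2)\in (K^{3\times 3})^2$ such that $A_1,A_2$ generate a nilpotent (non-unital) subalgebra of $K^{3\times 3}$. Degeneration order: $A\le_{\mathrm{deg}}B$ ($A$ degenerates to $B$) means $B\in\overline{\mathcal{O}(A)}$; this induces a partial order on the set of orbits. $\mathcal{O}(B)$ is a minimal degeneration of $\mathcal{O}(A)$ if $\mathcal{O}(B)\neq\mathcal{O}(A)$, $\mathcal{O}(B)\subseteq\overline{\mathcal{O}(A)}$, and there is no orbit $\mathcal{O}(Z)$ different from both with $A\le_{\mathrm{deg}}Z\le_{\mathrm{deg}}B$. A complete irredundant list of representatives of the $\mathrm{GL}_3(K)$-orbits in $\mathcal{N}_{3,2}$ is: $A_{\lambda,\mu}=(E_{21}+E_{32},\lambda(E_{21}+E_{32})+\mu E_{32})$ ($\lambda,\mu\in K$, $\mu\ne0$); $A_{\lambda,\infty}=(E_{21},\lambda E_{21}+E_{32})$ ($\lambda\in K$); $A_{\infty,\lambda}=(E_{32},E_{21}+\lambda E_{32})$ ($\lambda\in K$); $B_{\lambda,\mu}=(E_{21}+E_{32},\lambda(E_{21}+E_{32})+\mu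 E_{31})$ ($\lambda,\mu\in K$); $B_{\infty,\lambda}=(\lambda E_{31},E_{21}+E_{32})$ ($\lambda\in K$); $C=(E_{21},E_{31})$; $D=(E_{31},E_{32})$; $E_\lambda=(E_{21},\lambda E_{21})$ ($\lambda\in K$); $E_\infty=(0,E_{21})$; $O=(0,0)$. *)

theory Defs
  imports "HOL-Analysis.Analysis" "HOL-Computational_Algebra.Polynomial"
begin

type_synonym 'k matrix_pair = "('k^3^3) \<times> ('k^3^3)"

text \<open>On the type \<open>'k^3^3\<close> the library's \<open>*\<close> is the entrywise product; the matrix product is
  \<open>**\<close>, and the identity matrix is \<open>mat 1\<close>. The index type \<open>3\<close> has the elements \<open>1, 2, 3\<close>
  (where \<open>3 = 0\<close>).\<close>

definition mat_scale :: "'k::times \<Rightarrow> 'k^3^3 \<Rightarrow> 'k^3^3"  (infixr \<open>*ss\<close> 75)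
  where "c *ss M = (\<chi> i. c *s (M $ i))"

definition mat_unit :: "3 \<Rightarrow> 3 \<Rightarrow> 'k::zero_neq_one^3^3"
  where "mat_unit i j = (\<chi> r s. if r = i \<and> s = j then 1 else 0)"


section \<open>Pairs generating a nilpotent subalgebra\<close>

definition subalgebra :: "('k::field^3^3) set \<Rightarrow> bool"
  where "subalgebra S \<longleftrightarrow>
    0 \<in> S \<and> (\<forall>X\<in>S. \<forall>Y\<in>S. X + Y \<in> S) \<and> (\<forall>c. \<forall>X\<in>S. c *ss X \<in> S) \<and> (\<forall>X\<in>S. \<forall>Y\<in>S. X ** Y \<in> S)"

definition nilpotent_algebra :: "('k::field^3^3) set \<Rightarrow> bool"
  where "nilpotent_algebra S \<longleftrightarrow>
    (\<exists>n>0. \<forall>Xs. length Xs = n \<and> set Xs \<subseteq> S \<longrightarrow> foldr (**) Xs (mat 1) = 0)"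

definition nilpotent_pairs :: "'k::field matrix_pair set"
  where "nilpotent_pairs = {(A1, A2). nilpotent_algebra (subalgebra hull {A1, A2})}"


section \<open>Simultaneous conjugation\<close>

definition conj_pair :: "'k::field^3^3 \<Rightarrow> 'k matrix_pair \<Rightarrow> 'k matrix_pair"
  where "conj_pair g A = (g ** fst A ** matrix_inv g, g ** snd A ** matrix_inv g)"

definition orbit :: "'k::field matrix_pair \<Rightarrow> 'k matrix_pair set"
  where "orbit A = {conj_pair g A | g. invertible g}"


section \<open>Zariski closure\<close>

text \<open>The polynomial functions in the 18 matrix entries of a pair.\<close>

inductive polynomial_fun :: "('k::field matrix_pair \<Rightarrow> 'k) \<Rightarrow> bool"
  where
    const: "polynomial_fun (\<lambda>A. c)"
  | entry1: "polynomial_fun (\<lambda>A. fst A $ i $ j)"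
  | entry2: "polynomial_fun (\<lambda>A. snd A $ i $ j)"
  | add: "polynomial_fun f \<Longrightarrow> polynomial_fun g \<Longrightarrow> polynomial_fun (\<lambda>A. f A + g A)"
  | mult: "polynomial_fun f \<Longrightarrow> polynomial_fun g \<Longrightarrow> polynomial_fun (\<lambda>A. f A * g A)"

definition zariski_closed :: "'k::field matrix_pair set \<Rightarrow> bool"
  where "zariski_closed Z \<longleftrightarrow>
    (\<exists>F. (\<forall>f\<in>F. polynomial_fun f) \<and> Z = {A. \<forall>f\<in>F. f A = 0})"

definition zariski_closure :: "'k::field matrix_pair set \<Rightarrow> 'k matrix_pair set"
  where "zariski_closure S = zariski_closed hull S"


section \<open>Degenerations\<close>

definition deg_le :: "'k::field matrix_pair \<Rightarrow> 'k matrix_pair \<Rightarrow> bool"  (infix \<open>\<le>deg\<close> 50)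
  where "A \<le>deg B \<longleftrightarrow> B \<in> zariski_closure (orbit A)"

text \<open>\<open>minimal_degeneration A B\<close>: the orbit of \<open>B\<close> is a minimal degeneration of the orbit of \<open>A\<close>.\<close>

definition minimal_degeneration :: "'k::field matrix_pair \<Rightarrow> 'k matrix_pair \<Rightarrow> bool"
  where "minimal_degeneration A B \<longleftrightarrow>
    orbit B \<noteq> orbit A \<and> orbit B \<subseteq> zariski_closure (orbit A) \<and>
    \<not> (\<exists>Z. orbit Z \<noteq> orbit A \<and> orbit Z \<noteq> orbit B \<and> A \<le>deg Z \<and> Z \<le>deg B)"

definition minimal_degenerations :: "'k::field matrix_pair \<Rightarrow> 'k matrix_pair set set"
  where "minimal_degenerations A = {orbit B | B. minimal_degeneration A B}"


section \<open>Representatives of the orbits\<close>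

text \<open>A suffix \<open>_inf\<close> stands for an index \<open>\<infinity>\<close>: \<open>A_inf2 l\<close> is $A_{\lambda,\infty}$,
  \<open>A_inf1 l\<close> is $A_{\infty,\lambda}$ and \<open>B_inf1 l\<close> is $B_{\infty,\lambda}$.
  The family \<open>A_rep l m\<close> is only meant for \<open>m \<noteq> 0\<close>.\<close>

definition A_rep :: "'k::field \<Rightarrow> 'k \<Rightarrow> 'k matrix_pair"
  where "A_rep l m =
    (mat_unit 2 1 + mat_unit 3 2, l *ss (mat_unit 2 1 + mat_unit 3 2) + m *ss mat_unit 3 2)"

definition A_inf2 :: "'k::field \<Rightarrow> 'k matrix_pair"
  where "A_inf2 l = (mat_unit 2 1, l *ss mat_unit 2 1 + mat_unit 3 2)"

definition A_inf1 :: "'k::field \<Rightarrow> 'k matrix_pair"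
  where "A_inf1 l = (mat_unit 3 2, mat_unit 2 1 + l *ss mat_unit 3 2)"

definition B_rep :: "'k::field \<Rightarrow> 'k \<Rightarrow> 'k matrix_pair"
  where "B_rep l m =
    (mat_unit 2 1 + mat_unit 3 2, l *ss (mat_unit 2 1 + mat_unit 3 2) + m *ss mat_unit 3 1)"

definition B_inf1 :: "'k::field \<Rightarrow> 'k matrix_pair"
  where "B_inf1 l = (l *ss mat_unit 3 1, mat_unit 2 1 + mat_unit 3 2)"

definition C_rep :: "'k::field matrix_pair"
  where "C_rep = (mat_unit 2 1, mat_unit 3 1)"

definition D_rep :: "'k::field matrix_pair"
  where "D_rep = (mat_unit 3 1, mat_unit 3 2)"

definition E_rep :: "'k::field \<Rightarrow> 'k matrix_pair"
  where "E_rep l = (mat_unit 2 1, l *ss mat_unit 2 1)"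

definition E_inf :: "'k::field matrix_pair"
  where "E_inf = (0, mat_unit 2 1)"

definition O_rep :: "'k::field matrix_pair"
  where "O_rep = (0, 0)"


section \<open>The listed edges of the Hasse diagram\<close>

inductive hasse_edge :: "'k::field matrix_pair set \<Rightarrow> 'k matrix_pair set \<Rightarrow> bool"
  where
    A_C: "m \<noteq> 0 \<Longrightarrow> hasse_edge (orbit (A_rep l m)) (orbit C_rep)"
  | A_D: "m \<noteq> 0 \<Longrightarrow> hasse_edge (orbit (A_rep l m)) (orbit D_rep)"
  | A_inf2_C: "hasse_edge (orbit (A_inf2 l)) (orbit C_rep)"
  | A_inf2_D: "hasse_edge (orbit (A_inf2 l)) (orbit D_rep)"
  | A_inf1_C: "hasse_edge (orbit (A_inf1 l)) (orbit C_rep)"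
  | A_inf1_D: "hasse_edge (orbit (A_inf1 l)) (orbit D_rep)"
  | B_E: "hasse_edge (orbit (B_rep r l)) (orbit (E_rep r))"
  | B_inf1_E_inf: "hasse_edge (orbit (B_inf1 l)) (orbit E_inf)"
  | C_E: "hasse_edge (orbit C_rep) (orbit (E_rep r))"
  | C_E_inf: "hasse_edge (orbit C_rep) (orbit E_inf)"
  | D_E: "hasse_edge (orbit D_rep) (orbit (E_rep r))"
  | D_E_inf: "hasse_edge (orbit D_rep) (orbit E_inf)"
  | E_O: "hasse_edge (orbit (E_rep r)) (orbit O_rep)"
  | E_inf_O: "hasse_edge (orbit E_inf) (orbit O_rep)"

end

theory Submission
  imports Defs
begin

text \<open>
  A nilpotent pair is conjugate to a strictly lower triangular one, and such a pair is given by three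
  vectors \<open>x\<close>, \<open>y\<close>, \<open>z\<close> in \<open>K\<^sup>2\<close>: the coefficients of \<open>E\<^sub>2\<^sub>1\<close>, \<open>E\<^sub>3\<^sub>2\<close> and
  \<open>E\<^sub>3\<^sub>1\<close> in the two matrices (\<open>lower_pair x y z\<close>). Lower triangular conjugation moves them by
  \<open>x \<mapsto> a x\<close>, \<open>y \<mapsto> b y\<close>, \<open>z \<mapsto> a b z + q x + r y\<close>, and when \<open>y = 0\<close> or \<open>x = 0\<close> there is
  a further \<open>GL\<^sub>2\<close> acting on \<open>(x, z)\<close> or \<open>(y, z)\<close>. In these coordinates the list of
  representatives becomes uniform, without distinguished points at infinity: type A is
  \<open>x, y\<close> independent (then \<open>z\<close> can be made \<open>0\<close>), type B is \<open>x = y = p \<noteq> 0\<close>, C is \<open>y = 0\<close> with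
  \<open>x, z\<close> independent, D is \<open>x = 0\<close> with \<open>y, z\<close> independent, type E is \<open>(p, 0, 0)\<close> with
  \<open>p \<noteq> 0\<close> and depends only on the line through \<open>p\<close>, and O is zero.

  That one orbit degenerates to another is shown by a line \<open>t \<mapsto> M + t N\<close> of pairs that stays in the
  first orbit for \<open>t \<noteq> 0\<close>; since the field is infinite, its value at \<open>0\<close> lies in the closure
  (\<open>deg_le_limit\<close>). For instance \<open>(x, t y, y)\<close> has type A for \<open>t \<noteq> 0\<close> and type C for \<open>t = 0\<close>.

  That there are no further degenerations comes from equations that hold on an orbit and
  therefore on its closure. Most of them are noncommutative polynomial relations between the two
  matrices, which are automatically invariant under conjugation (\<open>nc_polynomial_zero_deg_le\<close>). For type
  A the products \<open>A\<^sub>i A\<^sub>j = y\<^sub>i x\<^sub>j E\<^sub>3\<^sub>1\<close> determine the lines of \<open>x\<close> and \<open>y\<close> unless all products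
  vanish; a pair of type B satisfies a relation expressing a linear combination of the two matrices
  as a multiple of the square of another, which recovers its parameter. C and D have the same relations, but C is a pair
  of columns times one common row and D is one common column times a pair of rows, and these
  two conditions are told apart by 2-by-2 minors (\<open>C_deg_le\<close>, \<open>D_deg_le\<close>).
  All products of three matrices vanish on each of these closures, so every pair in a closure
  is again conjugate to some \<open>lower_pair x y z\<close>, and evaluating the equations there lists the orbits
  of the closure completely. The Hasse diagram is then read off from these lists.
\<close>

section \<open>Orbits\<close>

lemma invertible_matrix_inv:
  fixes g :: "'k::field^3^3"
  assumes "invertible g"
  shows "g ** matrix_inv g = mat 1" "matrix_inv g ** g = mat 1"
  using assms unfolding invertible_def matrix_inv_def by (metis (mono_tags, lifting) someI_ex)+

text \<open>A matrix inverse as a second witness avoids reasoning about \<open>matrix_inv\<close>, which is defined by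
  a choice operator.\<close>

lemma orbit_iff_inverses:
  "B \<in> orbit A \<longleftrightarrow>
    (\<exists>g h. g ** h = mat 1 \<and> h ** g = mat 1 \<and> B = (g ** fst A ** h, g ** snd A ** h))"
proof
  assume "B \<in> orbit A"
  then show "\<exists>g h. g ** h = mat 1 \<and> h ** g = mat 1 \<and> B = (g ** fst A ** h, g ** snd A ** h)"
    unfolding orbit_def conj_pair_def using invertible_matrix_inv by blast
next
  assume "\<exists>g h. g ** h = mat 1 \<and> h ** g = mat 1 \<and> B = (g ** fst A ** h, g ** snd A ** h)"
  then obtain g h where gh: "g ** h = mat 1" "h ** g = mat 1"
    and B: "B = (g ** fst A ** h, g ** snd A ** h)" by blast
  have inv: "invertible g" using gh unfolding invertible_def by blast
  have "matrix_inv g = h"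
    by (metis gh(1) inv invertible_matrix_inv(2) matrix_mul_assoc matrix_mul_lid matrix_mul_rid)
  then show "B \<in> orbit A" unfolding orbit_def conj_pair_def using inv B by auto
qed

lemma orbit_refl: "A \<in> orbit A"
  unfolding orbit_iff_inverses by (intro exI[of _ "mat 1"]) simp

lemma orbit_sym:
  assumes "B \<in> orbit A"
  shows "A \<in> orbit B"
proof -
  obtain g h where gh: "g ** h = mat 1" "h ** g = mat 1"
    and B: "B = (g ** fst A ** h, g ** snd A ** h)"
    using assms unfolding orbit_iff_inverses by blast
  have "h ** (g ** X ** h) ** g = X" for X
    by (metis gh(2) matrix_mul_assoc matrix_mul_lid matrix_mul_rid)
  then have "A = (h ** fst B ** g, h ** snd B ** g)" using B by (simp add: prod_eq_iff)
  then show ?thesis unfolding orbit_iff_inverses using gh by blast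
qed

lemma orbit_trans:
  assumes "B \<in> orbit A" "C \<in> orbit B"
  shows "C \<in> orbit A"
proof -
  obtain g h where gh: "g ** h = mat 1" "h ** g = mat 1"
    and B: "B = (g ** fst A ** h, g ** snd A ** h)"
    using assms(1) unfolding orbit_iff_inverses by blast
  obtain k l where kl: "k ** l = mat 1" "l ** k = mat 1"
    and C: "C = (k ** fst B ** l, k ** snd B ** l)"
    using assms(2) unfolding orbit_iff_inverses by blast
  have "(k ** g) ** (h ** l) = mat 1" "(h ** l) ** (k ** g) = mat 1"
    using gh kl by (metis matrix_mul_assoc matrix_mul_rid)+
  moreover have "C = ((k ** g) ** fst A ** (h ** l), (k ** g) ** snd A ** (h ** l))"
    using B C by (simp add: matrix_mul_assoc)
  ultimately show ?thesis unfolding orbit_iff_inverses by blast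
qed

lemma orbit_eq_iff: "orbit A = orbit B \<longleftrightarrow> B \<in> orbit A"
  using orbit_refl orbit_sym orbit_trans by blast

text \<open>An intertwining equation is linear in the entries of \<open>g\<close>, so for an explicit \<open>g\<close> it is
  checked entry by entry, with no inverse to compute.\<close>

lemma orbit_eq_if_intertwined:
  fixes g :: "'k::field^3^3"
  assumes "det g \<noteq> 0" "g ** fst A = fst B ** g" "g ** snd A = snd B ** g"
  shows "orbit A = orbit B"
proof -
  have "invertible g" using assms(1) by (simp add: invertible_det_nz)
  then obtain h where gh: "g ** h = mat 1" "h ** g = mat 1" unfolding invertible_def by blast
  have "g ** fst A ** h = fst B" "g ** snd A ** h = snd B"
    using assms(2,3) gh by (metis matrix_mul_assoc matrix_mul_rid)+
  then have "B = (g ** fst A ** h, g ** snd A ** h)" by simp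
  then show ?thesis unfolding orbit_eq_iff orbit_iff_inverses using gh by blast
qed


section \<open>The degeneration order\<close>

lemma zariski_closure_iff:
  "B \<in> zariski_closure S \<longleftrightarrow>
    (\<forall>f. polynomial_fun f \<longrightarrow> (\<forall>A\<in>S. f A = 0) \<longrightarrow> f B = 0)"
proof
  assume B: "B \<in> zariski_closure S"
  show "\<forall>f. polynomial_fun f \<longrightarrow> (\<forall>A\<in>S. f A = 0) \<longrightarrow> f B = 0"
  proof (intro allI impI)
    fix f assume f: "polynomial_fun f" "\<forall>A\<in>S. f A = 0"
    have "zariski_closed {A. f A = 0}"
      unfolding zariski_closed_def using f(1) by (intro exI[of _ "{f}"]) auto
    then show "f B = 0"
      using B f(2) unfolding zariski_closure_def hull_def by auto
  qed
next
  assume *: "\<forall>f. polynomial_fun f \<longrightarrow> (\<forall>A\<in>S. f A = 0) \<longrightarrow> f B = 0"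
  show "B \<in> zariski_closure S"
    unfolding zariski_closure_def hull_def
  proof (rule InterI, clarify)
    fix Z assume Z: "zariski_closed Z" "S \<subseteq> Z"
    then show "B \<in> Z" unfolding zariski_closed_def using * by fastforce
  qed
qed

lemma deg_le_iff:
  "A \<le>deg B \<longleftrightarrow> (\<forall>f. polynomial_fun f \<longrightarrow> (\<forall>X\<in>orbit A. f X = 0) \<longrightarrow> f B = 0)"
  unfolding deg_le_def zariski_closure_iff ..

lemma polynomial_fun_sum:
  assumes "finite I" "\<And>i. i \<in> I \<Longrightarrow> polynomial_fun (f i)"
  shows "polynomial_fun (\<lambda>A. \<Sum>i\<in>I. f i A)"
  using assms by (induction I) (auto intro: polynomial_fun.intros)

definition polynomial_matrix_fun :: "('k::field matrix_pair \<Rightarrow> 'k^3^3) \<Rightarrow> bool"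
  where "polynomial_matrix_fun F \<longleftrightarrow> (\<forall>i j. polynomial_fun (\<lambda>A. F A $ i $ j))"

lemma polynomial_matrix_fun_intros:
  "polynomial_matrix_fun (\<lambda>A. M)"
  "polynomial_matrix_fun fst"
  "polynomial_matrix_fun snd"
  "polynomial_matrix_fun F \<Longrightarrow> polynomial_matrix_fun G \<Longrightarrow> polynomial_matrix_fun (\<lambda>A. F A + G A)"
  "polynomial_matrix_fun F \<Longrightarrow> polynomial_matrix_fun (\<lambda>A. c *ss F A)"
  "polynomial_matrix_fun F \<Longrightarrow> polynomial_matrix_fun G \<Longrightarrow> polynomial_matrix_fun (\<lambda>A. F A ** G A)"
  unfolding polynomial_matrix_fun_def
  by (auto simp: mat_scale_def matrix_matrix_mult_def
      intro!: polynomial_fun.intros polynomial_fun_sum)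

lemma polynomial_fun_comp:
  assumes "polynomial_fun f" "polynomial_matrix_fun F" "polynomial_matrix_fun G"
  shows "polynomial_fun (\<lambda>A. f (F A, G A))"
  using assms(1)
proof induction
  case (entry1 i j)
  then show ?case using assms(2) by (simp add: polynomial_matrix_fun_def)
next
  case (entry2 i j)
  then show ?case using assms(3) by (simp add: polynomial_matrix_fun_def)
qed (auto intro: polynomial_fun.intros)

lemma deg_le_refl: "A \<le>deg A"
  unfolding deg_le_iff using orbit_refl by blast

text \<open>The closure of an orbit is stable under conjugation: conjugation by a fixed matrix is a
  polynomial map, so composing with it turns an equation of the orbit into another one.\<close>

lemma deg_le_orbit:
  assumes "A \<le>deg B" "C \<in> orbit B"
  shows "A \<le>deg C"
  unfolding deg_le_iff
proof (intro allI impI)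
  fix f assume f: "polynomial_fun f" "\<forall>X\<in>orbit A. f X = 0"
  obtain g h where gh: "g ** h = mat 1" "h ** g = mat 1"
    and C: "C = (g ** fst B ** h, g ** snd B ** h)"
    using assms(2) unfolding orbit_iff_inverses by blast
  let ?f = "\<lambda>X. f (g ** fst X ** h, g ** snd X ** h)"
  have "polynomial_fun ?f"
    by (intro polynomial_fun_comp[OF f(1)] polynomial_matrix_fun_intros)
  moreover have "?f X = 0" if "X \<in> orbit A" for X
  proof -
    have "(g ** fst X ** h, g ** snd X ** h) \<in> orbit X"
      unfolding orbit_iff_inverses using gh by blast
    then show ?thesis using f(2) orbit_trans[OF that] by blast
  qed
  ultimately have "?f B = 0" using assms(1) unfolding deg_le_iff by blast
  then show "f C = 0" using C by simp
qed

lemma deg_le_trans: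
  assumes "A \<le>deg B" "B \<le>deg C"
  shows "A \<le>deg C"
  using assms deg_le_orbit[OF assms(1)] unfolding deg_le_iff by blast

lemma deg_le_if_orbit_eq: "orbit A = orbit B \<Longrightarrow> A \<le>deg B"
  unfolding deg_le_def using deg_le_def deg_le_refl by metis

lemma deg_le_cong:
  assumes "orbit A = orbit A'" "orbit B = orbit B'"
  shows "A \<le>deg B \<longleftrightarrow> A' \<le>deg B'"
  using assms deg_le_if_orbit_eq deg_le_trans by metis

lemma orbit_subset_closure_iff: "orbit B \<subseteq> zariski_closure (orbit A) \<longleftrightarrow> A \<le>deg B"
  using orbit_refl deg_le_orbit unfolding deg_le_def by blast

text \<open>Over a finite field, one plus the product of all \<open>X - a\<close> would have no root.\<close>

lemma infinite_UNIV_alg_closed: "infinite (UNIV :: 'k::alg_closed_field set)"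
proof
  assume fin: "finite (UNIV :: 'k set)"
  define p :: "'k poly" where "p = (\<Prod>a\<in>UNIV. [:- a, 1:])"
  have root: "poly p x = 0" for x
    unfolding p_def poly_prod using fin by (auto simp: prod_zero_iff)
  have "degree p = card (UNIV :: 'k set)"
    unfolding p_def by (subst degree_prod_eq_sum_degree) auto
  then have "degree p > 0" using fin by (simp add: card_gt_0_iff)
  then have "degree (p + 1) > 0" by (simp add: degree_add_eq_left)
  then obtain x where "poly (p + 1) x = 0" using alg_closed_imp_poly_has_root by blast
  then show False using root[of x] by simp
qed

text \<open>An equation of the orbit, restricted to the line, is a polynomial in \<open>t\<close> that vanishes at all
  \<open>t \<noteq> 0\<close>; it is the zero polynomial because the field is infinite.\<close>

lemma deg_le_limit:
  fixes \<gamma> :: "'k::alg_closed_field \<Rightarrow> 'k matrix_pair"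
  assumes lin: "\<And>t. \<gamma> t = (M1 + t *ss N1, M2 + t *ss N2)"
    and orb: "\<And>t. t \<noteq> 0 \<Longrightarrow> orbit (\<gamma> t) = orbit A"
  shows "A \<le>deg \<gamma> 0"
  unfolding deg_le_iff
proof (intro allI impI)
  fix f :: "'k matrix_pair \<Rightarrow> 'k"
  assume f: "polynomial_fun f" and zero: "\<forall>X\<in>orbit A. f X = 0"
  from f have "\<exists>p. \<forall>t. f (\<gamma> t) = poly p t"
  proof induction
    case (const c)
    show ?case by (intro exI[of _ "[:c:]"]) simp
  next
    case (entry1 i j)
    show ?case by (intro exI[of _ "[:M1$i$j, N1$i$j:]"]) (simp add: lin mat_scale_def)
  next
    case (entry2 i j)
    show ?case by (intro exI[of _ "[:M2$i$j, N2$i$j:]"]) (simp add: lin mat_scale_def)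
  next
    case (add f g)
    then show ?case by (metis poly_add)
  next
    case (mult f g)
    then show ?case by (metis poly_mult)
  qed
  then obtain p where p: "\<And>t. f (\<gamma> t) = poly p t" by blast
  have "poly p t = 0" if "t \<noteq> 0" for t
    using orb[OF that] orbit_refl zero p by metis
  then have "UNIV - {0} \<subseteq> {t. poly p t = 0}" by auto
  moreover have "infinite (UNIV - {0 :: 'k})" using infinite_UNIV_alg_closed by simp
  ultimately have "p = 0" using poly_roots_finite finite_subset by blast
  then show "f (\<gamma> 0) = 0" using p by simp
qed

text \<open>Noncommutative polynomials without constant term in the two matrices. They commute with
  simultaneous conjugation, so the vanishing of one is a closed condition on whole orbits.\<close>

inductive nc_polynomial :: "('k::field matrix_pair \<Rightarrow> 'k^3^3) \<Rightarrow> bool"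
  where
    "nc_polynomial fst"
  | "nc_polynomial snd"
  | "nc_polynomial F \<Longrightarrow> nc_polynomial G \<Longrightarrow> nc_polynomial (\<lambda>A. F A + G A)"
  | "nc_polynomial F \<Longrightarrow> nc_polynomial (\<lambda>A. c *ss F A)"
  | "nc_polynomial F \<Longrightarrow> nc_polynomial G \<Longrightarrow> nc_polynomial (\<lambda>A. F A ** G A)"

lemma mat_scale_mult:
  fixes A B :: "'k::field^3^3"
  shows "A ** (c *ss B) = c *ss (A ** B)" "(c *ss A) ** B = c *ss (A ** B)"
  by (simp_all add: vec_eq_iff mat_scale_def matrix_matrix_mult_def sum_distrib_left mult_ac)

lemma matrix_add_rdistrib:
  fixes A B C :: "'k::field^3^3"
  shows "(A + B) ** C = A ** C + B ** C"
  by (simp add: vec_eq_iff matrix_matrix_mult_def distrib_right sum.distrib)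

lemma nc_polynomial_conj:
  assumes "nc_polynomial F" "g ** h = mat 1" "h ** g = mat 1"
  shows "F (g ** fst A ** h, g ** snd A ** h) = g ** F A ** h"
  using assms(1)
proof induction
  case (3 F G)
  then show ?case by (simp add: matrix_add_ldistrib matrix_add_rdistrib)
next
  case (4 F c)
  then show ?case by (simp add: mat_scale_mult)
next
  case (5 F G)
  then show ?case using assms(3) by (metis matrix_mul_assoc matrix_mul_rid)
qed simp_all

lemma nc_polynomial_zero_deg_le:
  assumes "nc_polynomial F" "F A = 0" "A \<le>deg B"
  shows "F B = 0"
proof -
  have "polynomial_matrix_fun F"
    using assms(1) by induction (auto intro: polynomial_matrix_fun_intros)
  moreover have "F X = 0" if "X \<in> orbit A" for X
    using that nc_polynomial_conj[OF assms(1)] assms(2) unfolding orbit_iff_inverses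
    by (auto simp: matrix_matrix_mult_def vec_eq_iff)
  ultimately have *: "polynomial_matrix_fun F" "\<And>X. X \<in> orbit A \<Longrightarrow> F X = 0" by blast+
  have "F B $ i $ j = 0" for i j
  proof -
    have "polynomial_fun (\<lambda>A. F A $ i $ j)" using *(1) unfolding polynomial_matrix_fun_def by blast
    moreover have "\<forall>X\<in>orbit A. F X $ i $ j = 0" using *(2) by simp
    ultimately show ?thesis using assms(3) unfolding deg_le_iff by blast
  qed
  then show ?thesis by (simp add: vec_eq_iff)
qed


section \<open>Simultaneous strict triangularization\<close>

definition strictly_lower :: "'k \<Rightarrow> 'k \<Rightarrow> 'k \<Rightarrow> 'k::field^3^3"
  where "strictly_lower a b c =
    (\<chi> i j. if i = 2 \<and> j = 1 then a else if i = 3 \<and> j = 2 then b else if i = 3 \<and> j = 1 then c else 0)"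

definition lower_pair :: "'k^2 \<Rightarrow> 'k^2 \<Rightarrow> 'k^2 \<Rightarrow> 'k::field matrix_pair"
  where "lower_pair x y z = (strictly_lower (x$1) (y$1) (z$1), strictly_lower (x$2) (y$2) (z$2))"

text \<open>Take the least \<open>n\<close> for which all words of length \<open>n\<close> in \<open>S\<close> map everything into \<open>U\<close>. It is
  positive as \<open>U\<close> is proper, so some word of length \<open>n - 1\<close> takes a value outside \<open>U\<close>, and every
  element of \<open>S\<close> sends that value into \<open>U\<close>.\<close>

lemma vector_pushed_into:
  fixes S :: "('k::field^3^3) set"
  assumes nil: "\<exists>n. \<forall>ws. length ws = n \<and> set ws \<subseteq> S \<longrightarrow> foldr (**) ws (mat 1) = 0"
    and U: "U \<noteq> UNIV" "0 \<in> U"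
  shows "\<exists>v. v \<notin> U \<and> (\<forall>M\<in>S. M *v v \<in> U)"
proof -
  define Q where "Q n \<longleftrightarrow>
    (\<forall>ws x. length ws = n \<and> set ws \<subseteq> S \<longrightarrow> foldr (**) ws (mat 1) *v x \<in> U)" for n
  obtain n where n: "\<And>ws. length ws = n \<Longrightarrow> set ws \<subseteq> S \<Longrightarrow> foldr (**) ws (mat 1) = 0"
    using nil by auto
  have "Q n" unfolding Q_def using n U(2) by simp
  moreover have "\<not> Q 0" unfolding Q_def using U(1) by auto
  ultimately obtain m where m: "\<not> Q m" "Q (Suc m)"
    by (metis LeastI_ex Least_le lessI not_less old.nat.exhaust)
  then obtain ws x where ws: "length ws = m" "set ws \<subseteq> S" "foldr (**) ws (mat 1) *v x \<notin> U"
    unfolding Q_def by blast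
  have "M *v (foldr (**) ws (mat 1) *v x) \<in> U" if "M \<in> S" for M
  proof -
    have "foldr (**) (M # ws) (mat 1) *v x \<in> U"
      using m(2) ws that unfolding Q_def by (metis insert_subset length_Cons list.simps(15))
    then show ?thesis by (simp add: matrix_vector_mul_assoc)
  qed
  then show ?thesis using ws(3) by blast
qed

text \<open>Three applications of \<open>vector_pushed_into\<close>, with \<open>U\<close> the span of the vectors already found,
  give a basis in which both matrices are strictly lower triangular.\<close>

lemma orbit_lower_pair_if_words_vanish:
  fixes A :: "'k::field matrix_pair"
  assumes nil: "\<exists>n. \<forall>ws. length ws = n \<and> set ws \<subseteq> {fst A, snd A} \<longrightarrow> foldr (**) ws (mat 1) = 0"
  shows "\<exists>x y z. orbit A = orbit (lower_pair x y z)"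
proof -
  have not_full: "vec.span T \<noteq> UNIV" if "card T < 3" "finite T" for T :: "('k^3) set"
    using that vec.dim_le_card'[of T] vec.dim_span[of T] vec_dim_card[where 'n=3 and 'a='k]
    by (metis card_bit1 card_num1 leD mult_2 numeral_3_eq_3 one_add_one order_le_less_trans plus_1_eq_Suc numeral_2_eq_2)
  have ex: "\<exists>v. v \<notin> vec.span T \<and> (\<forall>M\<in>{fst A, snd A}. M *v v \<in> vec.span T)"
    if "card T < 3" "finite T" for T
    by (intro vector_pushed_into[OF nil] not_full that vec.span_zero)
  obtain v3 where v3: "v3 \<notin> vec.span {}" "fst A *v v3 \<in> vec.span {}" "snd A *v v3 \<in> vec.span {}"
    using ex[of "{}"] by auto
  obtain v2 where v2: "v2 \<notin> vec.span {v3}" "fst A *v v2 \<in> vec.span {v3}" "snd A *v v2 \<in> vec.span {v3}"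
    using ex[of "{v3}"] by auto
  have "card {v2, v3} < 3" using card_insert_le_m1[of 2 "{v3}" v2] by (simp add: card_insert_if)
  then obtain v1 where v1: "v1 \<notin> vec.span {v2, v3}" "fst A *v v1 \<in> vec.span {v2, v3}"
    "snd A *v v1 \<in> vec.span {v2, v3}"
    using ex[of "{v2, v3}"] by auto
  have nz: "v3 \<noteq> 0" using v3 by simp
  have lin3: "fst A *v v3 = 0" "snd A *v v3 = 0" using v3 by simp_all
  obtain y1 y2 where lin2: "fst A *v v2 = y1 *s v3" "snd A *v v2 = y2 *s v3"
    using v2 by (auto simp: vec.span_singleton)
  have span2: "\<exists>a b. v = a *s v2 + b *s v3" if "v \<in> vec.span {v2, v3}" for v
    using that by (metis (no_types, lifting) add.commute diff_add_cancel rangeE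
        vec.span_breakdown_eq vec.span_singleton)
  obtain x1 z1 where lin1: "fst A *v v1 = x1 *s v2 + z1 *s v3" using span2 v1(2) by blast
  obtain x2 z2 where lin1': "snd A *v v1 = x2 *s v2 + z2 *s v3" using span2 v1(3) by blast
  define g :: "'k^3^3" where "g = (\<chi> i j. if j = 1 then v1$i else if j = 2 then v2$i else v3$i)"
  have cols: "column 1 g = v1" "column 2 g = v2" "column 3 g = v3"
    unfolding g_def column_def by (simp_all add: vec_eq_iff)
  have "\<exists>h. h ** g = mat 1"
    unfolding matrix_left_invertible_independent_columns
  proof (intro allI impI)
    fix c :: "3 \<Rightarrow> 'k" and i
    assume "(\<Sum>i\<in>UNIV. c i *s column i g) = 0"
    then have s: "c 1 *s v1 + c 2 *s v2 + c 3 *s v3 = 0" by (simp add: sum_3 cols)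
    have c1: "c 1 = 0"
    proof (rule ccontr)
      assume nz: "c 1 \<noteq> 0"
      have "v1 = (- c 2 / c 1) *s v2 + (- c 3 / c 1) *s v3"
        using s nz by (simp add: vec_eq_iff field_simps add_eq_0_iff2)
      also have "\<dots> \<in> vec.span {v2, v3}"
        by (intro vec.span_add vec.span_scale vec.span_base) auto
      finally show False using v1(1) by blast
    qed
    have c2: "c 2 = 0"
    proof (rule ccontr)
      assume nz: "c 2 \<noteq> 0"
      have "v2 = (- c 3 / c 2) *s v3"
        using s c1 nz by (simp add: vec_eq_iff field_simps add_eq_0_iff2)
      then show False using v2(1) by (metis rangeI vec.span_singleton)
    qed
    have "c 3 = 0" using s c1 c2 nz by simp
    then show "c i = 0" using c1 c2 exhaust_3[of i] by auto
  qed
  then have "det g \<noteq> 0" by (simp add: invertible_left_inverse flip: invertible_det_nz)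
  define x y z :: "'k^2"
    where "x = vector [x1, x2]" and "y = vector [y1, y2]" and "z = vector [z1, z2]"
  have "fst A ** g = g ** fst (lower_pair x y z)" "snd A ** g = g ** snd (lower_pair x y z)"
    using lin1 lin1' lin2 lin3
    by (simp_all add: vec_eq_iff forall_3 matrix_matrix_mult_def matrix_vector_mult_def sum_3 g_def
        lower_pair_def strictly_lower_def x_def y_def z_def mult_ac)
  then have "orbit (lower_pair x y z) = orbit A"
    using \<open>det g \<noteq> 0\<close> by (intro orbit_eq_if_intertwined[of g]) simp_all
  then show ?thesis by metis
qed


section \<open>Conjugating strictly lower triangular pairs\<close>

definition wedge :: "'k::field^2 \<Rightarrow> 'k^2 \<Rightarrow> 'k"
  where "wedge u v = u$1 * v$2 - u$2 * v$1"

lemma wedge_scale: "wedge (a *s u) (b *s v) = a * b * wedge u v"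
  by (simp add: wedge_def algebra_simps)

lemma wedge_simps [simp]: "wedge u u = 0" "wedge 0 u = 0" "wedge u 0 = 0"
  by (simp_all add: wedge_def)

lemma wedge_commute: "wedge u v = - wedge v u"
  by (simp add: wedge_def)

lemma parallel_if_wedge_zero:
  assumes "p \<noteq> 0" "wedge x p = 0"
  shows "\<exists>c. x = c *s p"
proof (cases "p$1 = 0")
  case True
  then have "p$2 \<noteq> 0" using assms(1) by (simp add: vec_eq_iff forall_2)
  then show ?thesis using assms(2) True
    by (intro exI[of _ "x$2 / p$2"]) (simp add: vec_eq_iff forall_2 wedge_def)
next
  case False
  then show ?thesis using assms(2)
    by (intro exI[of _ "x$1 / p$1"]) (simp add: vec_eq_iff forall_2 wedge_def field_simps)
qed

lemma common_line_if_wedge_zero: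
  assumes "wedge x z = 0"
  shows "\<exists>p a b. p \<noteq> 0 \<and> x = a *s p \<and> z = b *s p"
proof (cases "z = 0")
  case False
  then show ?thesis using parallel_if_wedge_zero[OF False assms] by (metis vector_smult_lid)
next
  case True
  have "axis 1 1 \<noteq> (0 :: 'a^2)" by (simp add: axis_eq_0_iff)
  then show ?thesis
    using True by (cases "x = 0") (metis vector_smult_lid vector_smult_lzero)+
qed

lemma combination_if_wedge_nonzero:
  assumes "wedge x y \<noteq> 0"
  shows "\<exists>q r. z = q *s x + r *s y"
proof (intro exI)
  have "wedge x y * z$i = wedge z y * x$i + wedge x z * y$i" for i
    using exhaust_2[of i] by (auto simp: wedge_def algebra_simps)
  then show "z = (wedge z y / wedge x y) *s x + (wedge x z / wedge x y) *s y"
    using assms by (simp add: vec_eq_iff field_simps)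
qed

text \<open>The action of the lower triangular matrices on the coordinates \<open>x, y, z\<close>.\<close>

lemma orbit_lower_pair_rescale:
  fixes x y z :: "'k::field^2"
  assumes "a \<noteq> 0" "b \<noteq> 0"
  shows "orbit (lower_pair (a *s x) (b *s y) ((a * b) *s z + q *s x + r *s y)) =
    orbit (lower_pair x y z)"
proof -
  \<comment> \<open>The diagonal \<open>1, a, a b\<close> scales \<open>x\<close> and \<open>y\<close> by \<open>a\<close> and \<open>b\<close>; the other two entries contribute
      multiples of \<open>b y\<close> and \<open>x\<close> to \<open>z\<close>.\<close>
  define g :: "'k^3^3" where "g = vector [vector [1, 0, 0], vector [- r / b, a, 0], vector [0, q, a * b]]"
  have "det g \<noteq> 0" using assms by (simp add: det_3 g_def)
  then have "orbit (lower_pair x y z) =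
    orbit (lower_pair (a *s x) (b *s y) ((a * b) *s z + q *s x + r *s y))"
    using assms by (intro orbit_eq_if_intertwined[of g])
     (simp_all add: vec_eq_iff forall_3 matrix_matrix_mult_def sum_3 g_def
        lower_pair_def strictly_lower_def field_simps)
  then show ?thesis ..
qed

text \<open>When \<open>y = 0\<close> both matrices live in the first column, with entries \<open>x\<close> and \<open>z\<close> in rows 2 and 3,
  and the invertible matrices on these two rows mix \<open>x\<close> and \<open>z\<close>.\<close>

lemma orbit_lower_pair_rows:
  fixes x z :: "'k::field^2"
  assumes "a * d - b * c \<noteq> 0"
  shows "orbit (lower_pair (a *s x + b *s z) 0 (c *s x + d *s z)) = orbit (lower_pair x 0 z)"
proof -
  define g :: "'k^3^3" where "g = vector [vector [1, 0, 0], vector [0, a, b], vector [0, c, d]]"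
  have "det g \<noteq> 0" using assms by (simp add: det_3 g_def)
  then have "orbit (lower_pair x 0 z) = orbit (lower_pair (a *s x + b *s z) 0 (c *s x + d *s z))"
    by (intro orbit_eq_if_intertwined[of g])
     (simp_all add: vec_eq_iff forall_3 matrix_matrix_mult_def sum_3 g_def
        lower_pair_def strictly_lower_def)
  then show ?thesis ..
qed

text \<open>When \<open>x = 0\<close> both matrices live in the last row, with entries \<open>z\<close> and \<open>y\<close> in columns 1 and 2,
  and the invertible matrices on these two columns mix \<open>z\<close> and \<open>y\<close>.\<close>

lemma orbit_lower_pair_columns:
  fixes y z :: "'k::field^2"
  assumes "a * d - b * c \<noteq> 0"
  shows "orbit (lower_pair 0 (a *s y + b *s z) (c *s y + d *s z)) = orbit (lower_pair 0 y z)"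
proof -
  define g :: "'k^3^3" where "g = vector [vector [d, b, 0], vector [c, a, 0], vector [0, 0, 1]]"
  have "det g \<noteq> 0" using assms by (simp add: det_3 g_def mult.commute)
  then show ?thesis
    by (intro orbit_eq_if_intertwined[of g])
     (simp_all add: vec_eq_iff forall_3 matrix_matrix_mult_def sum_3 g_def
        lower_pair_def strictly_lower_def mult.commute add.commute)
qed

lemma orbit_rank_one_corner: "orbit (lower_pair 0 p 0) = orbit (lower_pair p 0 0)"
  using orbit_lower_pair_columns[of 0 0 1 1 0 p] orbit_lower_pair_rows[of 0 0 1 1 p 0]
  by (simp add: vec_eq_iff)

text \<open>Both matrices are multiples of a single matrix, which has rank at most one because
  \<open>a b = 0\<close>. If it is not zero, row or column operations move it to \<open>E\<^sub>2\<^sub>1\<close>, and only \<open>p\<close> is left.\<close>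

lemma orbit_rank_one:
  assumes "a = 0 \<or> b = 0"
  shows "orbit (lower_pair (a *s p) (b *s p) (c *s p)) \<in>
    {orbit (lower_pair p 0 0), orbit (lower_pair 0 0 0)}"
proof (cases "b = 0")
  case True
  consider "a \<noteq> 0" | "a = 0" "c \<noteq> 0" | "a = 0" "c = 0" by blast
  then show ?thesis
  proof cases
    case 1
    have "orbit (lower_pair ((1/a) *s (a *s p) + 0 *s (c *s p)) 0
        ((- c/a) *s (a *s p) + 1 *s (c *s p))) = orbit (lower_pair (a *s p) 0 (c *s p))"
      using 1 by (intro orbit_lower_pair_rows) simp
    then show ?thesis using 1 True by simp
  next
    case 2
    have "orbit (lower_pair (0 *s 0 + (1/c) *s (c *s p)) 0
        (1 *s 0 + 0 *s (c *s p))) = orbit (lower_pair 0 0 (c *s p))"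
      using 2 by (intro orbit_lower_pair_rows) simp
    then show ?thesis using 2 True by simp
  next
    case 3
    then show ?thesis using True by simp
  qed
next
  case False
  then have "orbit (lower_pair 0 ((1/b) *s (b *s p) + 0 *s (c *s p))
        ((- c/b) *s (b *s p) + 1 *s (c *s p))) = orbit (lower_pair 0 (b *s p) (c *s p))"
    by (intro orbit_lower_pair_columns) simp
  then show ?thesis using False assms orbit_rank_one_corner[of p] by auto
qed

lemma rep_lower_pair:
  "A_rep l m = lower_pair (vector [1, l]) (vector [1, l + m]) 0"
  "A_inf2 l = lower_pair (vector [1, l]) (vector [0, 1]) 0"
  "A_inf1 l = lower_pair (vector [0, 1]) (vector [1, l]) 0"
  "B_rep l m = lower_pair (vector [1, l]) (vector [1, l]) (vector [0, m])"
  "B_inf1 l = lower_pair (vector [0, 1]) (vector [0, 1]) (vector [l, 0])"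
  "C_rep = lower_pair (vector [1, 0]) 0 (vector [0, 1])"
  "D_rep = lower_pair 0 (vector [0, 1]) (vector [1, 0])"
  "E_rep l = lower_pair (vector [1, l]) 0 0"
  "E_inf = lower_pair (vector [0, 1]) 0 0"
  "O_rep = lower_pair 0 0 0"
  by (simp_all add: A_rep_def A_inf2_def A_inf1_def B_rep_def B_inf1_def C_rep_def D_rep_def
      E_rep_def E_inf_def O_rep_def lower_pair_def strictly_lower_def mat_unit_def mat_scale_def
      vec_eq_iff forall_3)

lemma orbit_C:
  assumes "wedge x z \<noteq> 0"
  shows "orbit (lower_pair x 0 z) = orbit C_rep"
proof -
  have "x = x$1 *s vector [1, 0] + x$2 *s vector [0, 1]"
    "z = z$1 *s vector [1, 0] + z$2 *s vector [0, 1]"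
    by (simp_all add: vec_eq_iff forall_2)
  then show ?thesis
    using orbit_lower_pair_rows[of "x$1" "z$2" "x$2" "z$1" "vector [1, 0]" "vector [0, 1]"] assms
    by (simp add: wedge_def rep_lower_pair)
qed

lemma orbit_D:
  assumes "wedge y z \<noteq> 0"
  shows "orbit (lower_pair 0 y z) = orbit D_rep"
proof -
  have "y = y$2 *s vector [0, 1] + y$1 *s vector [1, 0]"
    "z = z$2 *s vector [0, 1] + z$1 *s vector [1, 0]"
    by (simp_all add: vec_eq_iff forall_2)
  then show ?thesis
    using orbit_lower_pair_columns[of "y$2" "z$1" "y$1" "z$2" "vector [0, 1]" "vector [1, 0]"] assms
    by (simp add: wedge_def rep_lower_pair mult.commute)
qed

text \<open>\<open>x\<close> and \<open>y\<close> span the plane, so \<open>z\<close> can be cleared.\<close>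

lemma orbit_A:
  assumes "wedge x y \<noteq> 0" "a \<noteq> 0" "b \<noteq> 0"
  shows "orbit (lower_pair (a *s x) (b *s y) z) = orbit (lower_pair x y 0)"
proof -
  obtain q r where "z = q *s x + r *s y" using combination_if_wedge_nonzero[OF assms(1)] by blast
  then show ?thesis using orbit_lower_pair_rescale[OF assms(2,3), of x y 0 q r] by simp
qed

text \<open>Modulo \<open>p\<close>, the vector \<open>z\<close> is determined by \<open>wedge z p\<close>, and multiples of \<open>p\<close> can be added
  to it by conjugation.\<close>

lemma orbit_B:
  assumes "p \<noteq> 0" "a \<noteq> 0" "b \<noteq> 0" "wedge z' p = a * b * wedge z p"
  shows "orbit (lower_pair (a *s p) (b *s p) z') = orbit (lower_pair p p z)"
proof -
  have "wedge (z' - (a * b) *s z) p = 0" using assms(4) by (simp add: wedge_def algebra_simps)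
  then obtain q where "z' - (a * b) *s z = q *s p" using parallel_if_wedge_zero assms(1) by blast
  then have "z' = (a * b) *s z + q *s p + 0 *s p" by (simp add: algebra_simps)
  then show ?thesis using orbit_lower_pair_rescale[OF assms(2,3), of p p z q 0] by simp
qed

text \<open>The condition says that all four products of the two matrices vanish.\<close>

lemma orbit_product_zero:
  assumes "x = 0 \<or> y = 0"
  shows "orbit (lower_pair x y z) \<in>
    {orbit C_rep, orbit D_rep, orbit O_rep} \<union> {orbit (lower_pair p 0 0) | p. p \<noteq> 0}"
proof (cases "y = 0")
  case True
  show ?thesis
  proof (cases "wedge x z = 0")
    case False
    then show ?thesis using orbit_C[OF False] True by simp
  next
    case wz: True
    obtain p a c where "p \<noteq> 0" "x = a *s p" "z = c *s p"
      using common_line_if_wedge_zero[OF wz] by blast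
    then show ?thesis using orbit_rank_one[of a 0 p c] True by (auto simp: rep_lower_pair(10))
  qed
next
  case False
  then have x: "x = 0" using assms by blast
  show ?thesis
  proof (cases "wedge y z = 0")
    case False
    then show ?thesis using orbit_D[OF False] x by simp
  next
    case wz: True
    obtain p b c where "p \<noteq> 0" "y = b *s p" "z = c *s p"
      using common_line_if_wedge_zero[OF wz] by blast
    then show ?thesis using orbit_rank_one[of 0 b p c] x by (auto simp: rep_lower_pair(10))
  qed
qed

lemma orbit_classification:
  obtains (A) x' y' where "wedge x' y' \<noteq> 0" "orbit (lower_pair x y z) = orbit (lower_pair x' y' 0)"
    | (B) p z' where "p \<noteq> 0" "orbit (lower_pair x y z) = orbit (lower_pair p p z')"
    | (C) "orbit (lower_pair x y z) = orbit C_rep"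
    | (D) "orbit (lower_pair x y z) = orbit D_rep"
    | (E) p where "p \<noteq> 0" "orbit (lower_pair x y z) = orbit (lower_pair p 0 0)"
    | (O) "orbit (lower_pair x y z) = orbit O_rep"
proof -
  consider "x = 0 \<or> y = 0" | "wedge x y \<noteq> 0" | "x \<noteq> 0" "y \<noteq> 0" "wedge x y = 0" by blast
  then show ?thesis
  proof cases
    case 1
    then show ?thesis using orbit_product_zero[of x y z] C D E O by blast
  next
    case 2
    then show ?thesis using orbit_A[of x y 1 1 z] A by simp
  next
    case 3
    then obtain p a b where p: "p \<noteq> 0" "x = a *s p" "y = b *s p"
      using common_line_if_wedge_zero by blast
    then have ab: "a \<noteq> 0" "b \<noteq> 0" using 3 by auto
    have "orbit (lower_pair x y z) = orbit (lower_pair p p ((1 / (a * b)) *s z))"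
      unfolding p using ab p(1) by (intro orbit_B) (simp_all add: wedge_def field_simps)
    then show ?thesis using B p(1) by blast
  qed
qed


section \<open>Closed conditions on degenerations\<close>

lemma strictly_lower_simps:
  "strictly_lower a b c ** strictly_lower a' b' c' = strictly_lower 0 0 (b * a')"
  "strictly_lower a b c + strictly_lower a' b' c' = strictly_lower (a + a') (b + b') (c + c')"
  "t *ss strictly_lower a b c = strictly_lower (t * a) (t * b) (t * c)"
  "strictly_lower a b c = 0 \<longleftrightarrow> a = 0 \<and> b = 0 \<and> c = 0"
  by (auto simp: strictly_lower_def matrix_matrix_mult_def sum_3 vec_eq_iff forall_3 mat_scale_def)

lemma lower_pair_components:
  "fst (lower_pair x y z) = strictly_lower (x$1) (y$1) (z$1)"
  "snd (lower_pair x y z) = strictly_lower (x$2) (y$2) (z$2)"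
  by (simp_all add: lower_pair_def)

text \<open>The member of the pencil spanned by the two matrices in which every coordinate vector
  parallel to \<open>p\<close> contributes zero.\<close>

definition pencil :: "'k^2 \<Rightarrow> 'k::field matrix_pair \<Rightarrow> 'k^3^3"
  where "pencil p A = p$2 *ss fst A + (- p$1) *ss snd A"

lemma nc_polynomial_pencil: "nc_polynomial (pencil p)"
  unfolding pencil_def[abs_def] by (intro nc_polynomial.intros)

lemma pencil_lower_pair:
  "pencil p (lower_pair x y z) = strictly_lower (wedge x p) (wedge y p) (wedge z p)"
  by (simp add: pencil_def lower_pair_def strictly_lower_simps wedge_def mult.commute)

lemma product_zero_deg_le:
  assumes "lower_pair x y z \<le>deg lower_pair x' y' z'" "x = 0 \<or> y = 0"
  shows "x' = 0 \<or> y' = 0"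
proof -
  have "y'$1 * x'$1 = 0" "y'$1 * x'$2 = 0" "y'$2 * x'$1 = 0" "y'$2 * x'$2 = 0"
    using nc_polynomial_zero_deg_le[OF _ _ assms(1), of "\<lambda>A. fst A ** fst A"]
      nc_polynomial_zero_deg_le[OF _ _ assms(1), of "\<lambda>A. fst A ** snd A"]
      nc_polynomial_zero_deg_le[OF _ _ assms(1), of "\<lambda>A. snd A ** fst A"]
      nc_polynomial_zero_deg_le[OF _ _ assms(1), of "\<lambda>A. snd A ** snd A"] assms(2)
    by (auto simp: lower_pair_components strictly_lower_simps nc_polynomial.intros)
  then show ?thesis by (auto simp: vec_eq_iff forall_2)
qed

lemma pencil_deg_le:
  assumes "lower_pair x y z \<le>deg lower_pair x' y' z'"
    "wedge x p = 0" "wedge y p = 0" "wedge z p = 0"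
  shows "wedge x' p = 0" "wedge y' p = 0" "wedge z' p = 0"
  using nc_polynomial_zero_deg_le[OF nc_polynomial_pencil _ assms(1), of p] assms(2-4)
  by (simp_all add: pencil_lower_pair strictly_lower_simps)

text \<open>On type A the matrix \<open>pencil x\<close> has no \<open>E\<^sub>2\<^sub>1\<close> part, so it is annihilated by left
  multiplication with both matrices; dually \<open>pencil y\<close> is annihilated on the right. Both are closed
  conditions.\<close>

lemma A_deg_le:
  assumes "lower_pair x y 0 \<le>deg lower_pair x' y' z'"
  shows "y' = 0 \<or> wedge x' x = 0" "x' = 0 \<or> wedge y' y = 0"
proof -
  note nc = nc_polynomial.intros nc_polynomial_pencil
  note eval = nc pencil_lower_pair lower_pair_components strictly_lower_simps
  have "y'$1 * wedge x' x = 0" "y'$2 * wedge x' x = 0"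
    using nc_polynomial_zero_deg_le[OF _ _ assms, of "\<lambda>A. fst A ** pencil x A"]
      nc_polynomial_zero_deg_le[OF _ _ assms, of "\<lambda>A. snd A ** pencil x A"]
    by (simp_all add: eval)
  then show "y' = 0 \<or> wedge x' x = 0" by (auto simp: vec_eq_iff forall_2)
  have "wedge y' y * x'$1 = 0" "wedge y' y * x'$2 = 0"
    using nc_polynomial_zero_deg_le[OF _ _ assms, of "\<lambda>A. pencil y A ** fst A"]
      nc_polynomial_zero_deg_le[OF _ _ assms, of "\<lambda>A. pencil y A ** snd A"]
    by (simp_all add: eval)
  then show "x' = 0 \<or> wedge y' y = 0" by (auto simp: vec_eq_iff forall_2)
qed

text \<open>On type B, \<open>pencil p\<close> is a multiple of \<open>E\<^sub>3\<^sub>1\<close>, and so is the square of any combination of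
  the two matrices with \<open>E\<^sub>2\<^sub>1 + E\<^sub>3\<^sub>2\<close> as its leading part. Comparing them gives a relation that pins
  down the class of \<open>z\<close> modulo \<open>p\<close>.\<close>

lemma B_deg_le:
  assumes "lower_pair p p z \<le>deg lower_pair x' y' z'" "p \<noteq> 0"
  shows "\<exists>a b. x' = a *s p \<and> y' = b *s p \<and> wedge z' p = a * b * wedge z p"
proof -
  \<comment> \<open>A linear form with value 1 at \<open>p\<close>; applied to the pair it gives the matrix to be squared.\<close>
  have "\<exists>c1 c2. c1 * p$1 + c2 * p$2 = 1"
  proof (cases "p$1 = 0")
    case True
    then have "p$2 \<noteq> 0" using assms(2) by (simp add: vec_eq_iff forall_2)
    then show ?thesis by (intro exI[of _ 0] exI[of _ "1 / p$2"]) simp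
  next
    case False
    then show ?thesis by (intro exI[of _ "1 / p$1"] exI[of _ 0]) simp
  qed
  then obtain c1 c2 where c: "c1 * p$1 + c2 * p$2 = 1" by blast
  define u where "u A = c1 *ss fst A + c2 *ss snd A" for A :: "'a matrix_pair"
  define F where "F A = pencil p A + (- wedge z p) *ss (u A ** u A)" for A
  have nc: "nc_polynomial F"
    unfolding F_def[abs_def] u_def[abs_def] by (intro nc_polynomial.intros nc_polynomial_pencil)
  have F: "F (lower_pair x y w) = strictly_lower (wedge x p) (wedge y p)
      (wedge w p - wedge z p * ((c1 * y$1 + c2 * y$2) * (c1 * x$1 + c2 * x$2)))" for x y w
    unfolding F_def pencil_lower_pair u_def by (simp add: lower_pair_def strictly_lower_simps)
  have "F (lower_pair p p z) = 0" by (simp add: F strictly_lower_simps c)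
  then have F0: "F (lower_pair x' y' z') = 0" using nc_polynomial_zero_deg_le[OF nc _ assms(1)] by blast
  then have "wedge x' p = 0" "wedge y' p = 0" by (simp_all add: F strictly_lower_simps)
  then obtain a b where ab: "x' = a *s p" "y' = b *s p"
    using parallel_if_wedge_zero[OF assms(2)] by metis
  have "c1 * (t *s p)$1 + c2 * (t *s p)$2 = t" for t
    using arg_cong[OF c, of "\<lambda>s. t * s"] by (simp add: algebra_simps)
  then have "wedge z' p = a * b * wedge z p"
    using F0 unfolding F strictly_lower_simps ab by (simp add: mult_ac)
  then show ?thesis using ab by blast
qed

lemma conj_rank_one_entries:
  "(g ** strictly_lower a 0 c ** h) $ i $ j = (g$i$2 * a + g$i$3 * c) * h$1$j"
  "(g ** strictly_lower 0 b c ** h) $ i $ j = g$i$3 * (b * h$2$j + c * h$1$j)"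
  by (simp_all add: matrix_matrix_mult_def sum_3 strictly_lower_def algebra_simps)

text \<open>If \<open>y = 0\<close>, both matrices are a column times the same row, also after conjugation. Hence
  any row of one is parallel to any row of the other; the minor used here involves their third rows.\<close>

lemma C_deg_le:
  assumes "lower_pair x 0 z \<le>deg lower_pair x' y' z'"
  shows "wedge y' z' = 0"
proof -
  let ?f = "\<lambda>A. fst A $ 3 $ 2 * snd A $ 3 $ 1 + (- 1) * (fst A $ 3 $ 1 * snd A $ 3 $ 2)"
  have "polynomial_fun ?f" by (intro polynomial_fun.intros)
  moreover have "?f X = 0" if "X \<in> orbit (lower_pair x 0 z)" for X
    using that unfolding orbit_iff_inverses
    by (auto simp: lower_pair_components conj_rank_one_entries mult_ac)
  ultimately have "?f (lower_pair x' y' z') = 0" using assms unfolding deg_le_iff by blast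
  then show ?thesis by (simp add: lower_pair_def strictly_lower_def wedge_def mult.commute)
qed

text \<open>The transposed form of the previous argument: if \<open>x = 0\<close>, both matrices are the same column
  times a row, so their first columns are parallel.\<close>

lemma D_deg_le:
  assumes "lower_pair 0 y z \<le>deg lower_pair x' y' z'"
  shows "wedge x' z' = 0"
proof -
  let ?f = "\<lambda>A. fst A $ 2 $ 1 * snd A $ 3 $ 1 + (- 1) * (fst A $ 3 $ 1 * snd A $ 2 $ 1)"
  have "polynomial_fun ?f" by (intro polynomial_fun.intros)
  moreover have "?f X = 0" if "X \<in> orbit (lower_pair 0 y z)" for X
    using that unfolding orbit_iff_inverses
    by (auto simp: lower_pair_components conj_rank_one_entries mult_ac)
  ultimately have "?f (lower_pair x' y' z') = 0" using assms unfolding deg_le_iff by blast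
  then show ?thesis by (simp add: lower_pair_def strictly_lower_def wedge_def mult.commute)
qed


section \<open>The orbits below each representative\<close>

definition E_orbits :: "'k::field matrix_pair set set"
  where "E_orbits = {orbit (lower_pair p 0 0) | p. p \<noteq> 0}"

lemma strictly_lower_products_zero:
  assumes "X = lower_pair x y z" "{M1, M2, M3} \<subseteq> {fst X, snd X}"
  shows "M1 ** (M2 ** M3) = 0"
  using assms by (auto simp: lower_pair_def strictly_lower_simps)

text \<open>The vanishing of all products of three matrices is a closed condition, so every pair in the
  closure can itself be made strictly lower triangular, without leaving the closure.\<close>

lemma degeneration_lower_pair:
  assumes "lower_pair x y z \<le>deg Y"
  obtains x' y' z' where "orbit Y = orbit (lower_pair x' y' z')"
    "lower_pair x y z \<le>deg lower_pair x' y' z'"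
proof -
  have prod: "F Y ** (G Y ** H Y) = 0" if "{F, G, H} \<subseteq> {fst, snd}" for F G H
  proof -
    have "nc_polynomial F" "nc_polynomial G" "nc_polynomial H"
      using that nc_polynomial.intros(1,2) by auto
    then have nc: "nc_polynomial (\<lambda>A. F A ** (G A ** H A))" by (intro nc_polynomial.intros)
    show ?thesis
      by (rule nc_polynomial_zero_deg_le[OF nc _ assms], rule strictly_lower_products_zero[OF refl])
        (use that in auto)
  qed
  have "foldr (**) ws (mat 1) = 0" if len: "length ws = 3" and ws: "set ws \<subseteq> {fst Y, snd Y}" for ws
  proof -
    obtain M1 M2 M3 where eq: "ws = [M1, M2, M3]"
      using len by (auto simp: length_Suc_conv numeral_3_eq_3)
    obtain F G H where "{F, G, H} \<subseteq> {fst, snd}" "M1 = F Y" "M2 = G Y" "M3 = H Y"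
      using ws unfolding eq by auto
    then show ?thesis using prod eq by simp
  qed
  then obtain x' y' z' where eq: "orbit Y = orbit (lower_pair x' y' z')"
    using orbit_lower_pair_if_words_vanish[of Y] by blast
  then show thesis using that assms deg_le_cong[OF refl eq] by blast
qed

lemma degenerations_A:
  assumes "wedge x y \<noteq> 0" "lower_pair x y 0 \<le>deg Y"
  shows "orbit Y \<in> {orbit (lower_pair x y 0), orbit C_rep, orbit D_rep, orbit O_rep} \<union> E_orbits"
  using assms(2)
proof (rule degeneration_lower_pair)
  fix x' y' z'
  assume Y: "orbit Y = orbit (lower_pair x' y' z')" and le: "lower_pair x y 0 \<le>deg lower_pair x' y' z'"
  have nz: "x \<noteq> 0" "y \<noteq> 0" using assms(1) by auto
  show ?thesis
  proof (cases "x' = 0 \<or> y' = 0")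
    case True
    then show ?thesis unfolding Y using orbit_product_zero[of x' y' z'] unfolding E_orbits_def by blast
  next
    case False
    then obtain a b where "x' = a *s x" "y' = b *s y"
      using A_deg_le[OF le] parallel_if_wedge_zero nz by blast
    moreover have "a \<noteq> 0" "b \<noteq> 0" using False calculation by auto
    ultimately show ?thesis unfolding Y using orbit_A[OF assms(1)] by simp
  qed
qed

text \<open>If \<open>a b = 0\<close>, the relation of \<open>B_deg_le\<close> forces \<open>z'\<close> onto the line of \<open>p\<close> as well, and the
  pair collapses to a multiple of a single matrix.\<close>

lemma degenerations_B:
  assumes "p \<noteq> 0" "lower_pair p p z \<le>deg Y"
  shows "orbit Y \<in> {orbit (lower_pair p p z), orbit (lower_pair p 0 0), orbit O_rep}"
  using assms(2)
proof (rule degeneration_lower_pair)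
  fix x' y' z'
  assume Y: "orbit Y = orbit (lower_pair x' y' z')" and le: "lower_pair p p z \<le>deg lower_pair x' y' z'"
  obtain a b where ab: "x' = a *s p" "y' = b *s p" "wedge z' p = a * b * wedge z p"
    using B_deg_le[OF le assms(1)] by blast
  show ?thesis
  proof (cases "a = 0 \<or> b = 0")
    case True
    then have "wedge z' p = 0" using ab(3) by auto
    then obtain c where "z' = c *s p" using parallel_if_wedge_zero[OF assms(1)] by blast
    then show ?thesis unfolding Y ab using orbit_rank_one[OF True] by (simp add: rep_lower_pair(10))
  next
    case False
    then show ?thesis unfolding Y ab using orbit_B[OF assms(1) _ _ ab(3)] by simp
  qed
qed

lemma degenerations_rank_one:
  assumes "p \<noteq> 0" "lower_pair p 0 0 \<le>deg Y"
  shows "orbit Y \<in> {orbit (lower_pair p 0 0), orbit O_rep}"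
  using assms(2)
proof (rule degeneration_lower_pair)
  fix x' y' z'
  assume Y: "orbit Y = orbit (lower_pair x' y' z')" and le: "lower_pair p 0 0 \<le>deg lower_pair x' y' z'"
  have "wedge x' p = 0" "wedge y' p = 0" "wedge z' p = 0" using pencil_deg_le[OF le, of p] by simp_all
  then obtain a b c where abc: "x' = a *s p" "y' = b *s p" "z' = c *s p"
    using parallel_if_wedge_zero[OF assms(1)] by meson
  have "a = 0 \<or> b = 0" using product_zero_deg_le[OF le] assms(1) unfolding abc by auto
  then show ?thesis unfolding Y abc using orbit_rank_one by (simp add: rep_lower_pair(10))
qed

lemma degenerations_C:
  assumes "C_rep \<le>deg Y"
  shows "orbit Y \<in> {orbit C_rep, orbit O_rep} \<union> E_orbits"
  using assms unfolding rep_lower_pair(6)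
proof (rule degeneration_lower_pair, fold rep_lower_pair(6))
  fix x' y' z'
  assume Y: "orbit Y = orbit (lower_pair x' y' z')" and le: "C_rep \<le>deg lower_pair x' y' z'"
  have xy: "x' = 0 \<or> y' = 0" using product_zero_deg_le le unfolding rep_lower_pair by blast
  have yz: "wedge y' z' = 0" using C_deg_le le unfolding rep_lower_pair by blast
  show ?thesis
  proof (cases "x' = 0")
    case True
    obtain p b c where "p \<noteq> 0" "y' = b *s p" "z' = c *s p"
      using common_line_if_wedge_zero[OF yz] by blast
    then show ?thesis unfolding Y E_orbits_def using orbit_rank_one[of 0 b p c] True
      by (auto simp: rep_lower_pair(10))
  next
    case False
    then have y: "y' = 0" using xy by blast
    show ?thesis
    proof (cases "wedge x' z' = 0")
      case True
      then obtain p a c where "p \<noteq> 0" "x' = a *s p" "z' = c *s p"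
        using common_line_if_wedge_zero by blast
      then show ?thesis unfolding Y E_orbits_def using orbit_rank_one[of a 0 p c] y
        by (auto simp: rep_lower_pair(10))
    next
      case False
      then show ?thesis unfolding Y using orbit_C[OF False] y by simp
    qed
  qed
qed

lemma degenerations_D:
  assumes "D_rep \<le>deg Y"
  shows "orbit Y \<in> {orbit D_rep, orbit O_rep} \<union> E_orbits"
  using assms unfolding rep_lower_pair(7)
proof (rule degeneration_lower_pair, fold rep_lower_pair(7))
  fix x' y' z'
  assume Y: "orbit Y = orbit (lower_pair x' y' z')" and le: "D_rep \<le>deg lower_pair x' y' z'"
  have xy: "x' = 0 \<or> y' = 0" using product_zero_deg_le le unfolding rep_lower_pair by blast
  have xz: "wedge x' z' = 0" using D_deg_le le unfolding rep_lower_pair by blast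
  show ?thesis
  proof (cases "y' = 0")
    case True
    obtain p a c where "p \<noteq> 0" "x' = a *s p" "z' = c *s p"
      using common_line_if_wedge_zero[OF xz] by blast
    then show ?thesis unfolding Y E_orbits_def using orbit_rank_one[of a 0 p c] True
      by (auto simp: rep_lower_pair(10))
  next
    case False
    then have x: "x' = 0" using xy by blast
    show ?thesis
    proof (cases "wedge y' z' = 0")
      case True
      then obtain p b c where "p \<noteq> 0" "y' = b *s p" "z' = c *s p"
        using common_line_if_wedge_zero by blast
      then show ?thesis unfolding Y E_orbits_def using orbit_rank_one[of 0 b p c] x
        by (auto simp: rep_lower_pair(10))
    next
      case False
      then show ?thesis unfolding Y using orbit_D[OF False] x by simp
    qed
  qed
qed

lemma degenerations_O:
  assumes "O_rep \<le>deg Y"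
  shows "orbit Y = orbit O_rep"
proof -
  have "fst Y = 0" "snd Y = 0"
    using nc_polynomial_zero_deg_le[OF nc_polynomial.intros(1) _ assms]
      nc_polynomial_zero_deg_le[OF nc_polynomial.intros(2) _ assms]
    by (simp_all add: O_rep_def)
  then have "Y = O_rep" by (simp add: O_rep_def prod_eq_iff)
  then show ?thesis by simp
qed


section \<open>Degenerations along lines\<close>

lemma lower_pair_line:
  "lower_pair (x + t *s x') (y + t *s y') (z + t *s z') =
    (fst (lower_pair x y z) + t *ss fst (lower_pair x' y' z'),
     snd (lower_pair x y z) + t *ss snd (lower_pair x' y' z'))"
  by (simp add: lower_pair_def strictly_lower_simps)

lemma deg_le_lower_pair_limit:
  fixes x y z x' y' z' :: "'k::alg_closed_field^2"
  assumes "\<And>t. t \<noteq> 0 \<Longrightarrow>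
    orbit (lower_pair (x + t *s x') (y + t *s y') (z + t *s z')) = orbit A"
  shows "A \<le>deg lower_pair x y z"
  using deg_le_limit[of "\<lambda>t. lower_pair (x + t *s x') (y + t *s y') (z + t *s z')", OF lower_pair_line assms]
  by simp

text \<open>The line \<open>(x, t y, y)\<close>: for \<open>t \<noteq> 0\<close> the vectors \<open>x\<close> and \<open>t y\<close> span the same two lines, and at
  \<open>t = 0\<close> the remaining \<open>x\<close> and \<open>y\<close> make a pair of type C.\<close>

lemma A_deg_le_C:
  fixes x y :: "'k::alg_closed_field^2"
  assumes "wedge x y \<noteq> 0"
  shows "lower_pair x y 0 \<le>deg C_rep"
proof -
  have "lower_pair x y 0 \<le>deg lower_pair x 0 y"
    using orbit_A[OF assms, of 1] by (intro deg_le_lower_pair_limit[of x 0 0 y y 0]) simp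
  then show ?thesis using orbit_C[OF assms] deg_le_cong by blast
qed

lemma A_deg_le_D:
  fixes x y :: "'k::alg_closed_field^2"
  assumes "wedge x y \<noteq> 0"
  shows "lower_pair x y 0 \<le>deg D_rep"
proof -
  have "wedge y x \<noteq> 0" using assms wedge_commute[of y x] by simp
  moreover have "lower_pair x y 0 \<le>deg lower_pair 0 y x"
    using orbit_A[OF assms, of _ 1] by (intro deg_le_lower_pair_limit[of 0 x y 0 x 0]) simp
  ultimately show ?thesis using orbit_D deg_le_cong by blast
qed

text \<open>The line \<open>(p, t p, t z)\<close>: scaling \<open>y\<close> by \<open>t\<close> under conjugation scales \<open>z\<close> by \<open>t\<close> too, so it
  stays in the orbit for \<open>t \<noteq> 0\<close>.\<close>

lemma B_deg_le_rank_one: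
  fixes p z :: "'k::alg_closed_field^2"
  assumes "p \<noteq> 0"
  shows "lower_pair p p z \<le>deg lower_pair p 0 0"
  using orbit_B[OF assms, of 1] by (intro deg_le_lower_pair_limit[of p 0 0 p 0 z]) (simp add: wedge_def algebra_simps)

lemma wedge_complement:
  fixes p :: "'k::field^2"
  assumes "p \<noteq> 0"
  shows "\<exists>s. wedge p s \<noteq> 0"
proof (cases "p$1 = 0")
  case True
  then have "p$2 \<noteq> 0" using assms by (simp add: vec_eq_iff forall_2)
  then show ?thesis by (intro exI[of _ "vector [1, 0]"]) (simp add: wedge_def)
next
  case False
  then show ?thesis by (intro exI[of _ "vector [0, 1]"]) (simp add: wedge_def)
qed

text \<open>Any basis \<open>p, t s\<close> of the plane represents C, and the second vector can be shrunk to zero.\<close>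

lemma C_deg_le_rank_one:
  fixes p :: "'k::alg_closed_field^2"
  assumes "p \<noteq> 0"
  shows "C_rep \<le>deg lower_pair p 0 0"
proof -
  obtain s where s: "wedge p s \<noteq> 0" using wedge_complement[OF assms] by blast
  have "orbit (lower_pair p 0 (t *s s)) = orbit C_rep" if "t \<noteq> 0" for t
    using s that wedge_scale[of 1 p t s] by (intro orbit_C) simp
  then show ?thesis by (intro deg_le_lower_pair_limit[of p 0 0 0 0 s]) simp
qed

lemma D_deg_le_rank_one:
  fixes p :: "'k::alg_closed_field^2"
  assumes "p \<noteq> 0"
  shows "D_rep \<le>deg lower_pair p 0 0"
proof -
  obtain s where s: "wedge p s \<noteq> 0" using wedge_complement[OF assms] by blast
  have "orbit (lower_pair 0 p (t *s s)) = orbit D_rep" if "t \<noteq> 0" for t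
    using s that wedge_scale[of 1 p t s] by (intro orbit_D) simp
  then have "D_rep \<le>deg lower_pair 0 p 0" by (intro deg_le_lower_pair_limit[of 0 0 p 0 0 s]) simp
  then show ?thesis using orbit_rank_one_corner deg_le_cong by blast
qed

lemma rank_one_deg_le_O:
  fixes p :: "'k::alg_closed_field^2"
  shows "lower_pair p 0 0 \<le>deg O_rep"
  unfolding rep_lower_pair
proof (rule deg_le_lower_pair_limit[of 0 p 0 0 0 0])
  fix t :: 'k assume "t \<noteq> 0"
  then show "orbit (lower_pair (0 + t *s p) (0 + t *s 0) (0 + t *s 0)) = orbit (lower_pair p 0 0)"
    using orbit_lower_pair_rescale[of t 1 p 0 0 0 0] by simp
qed


section \<open>Families of representatives\<close>

text \<open>The point of the projective line given by \<open>x\<close>, then that given by \<open>y\<close>, is finite or infinite;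
  this is the source of the three named families.\<close>

lemma orbit_A_named:
  assumes "wedge x y \<noteq> 0"
  obtains l m where "m \<noteq> 0" "orbit (lower_pair x y 0) = orbit (A_rep l m)"
    | l where "orbit (lower_pair x y 0) = orbit (A_inf2 l)"
    | l where "orbit (lower_pair x y 0) = orbit (A_inf1 l)"
proof -
  consider "x$1 \<noteq> 0" "y$1 \<noteq> 0" | "x$1 \<noteq> 0" "y$1 = 0" | "x$1 = 0" by blast
  then show ?thesis
  proof cases
    case 1
    define l m where "l = x$2 / x$1" and "m = y$2 / y$1 - l"
    have eq: "x = x$1 *s vector [1, l]" "y = y$1 *s vector [1, l + m]"
      using 1 by (simp_all add: vec_eq_iff forall_2 l_def m_def)
    have "m \<noteq> 0" using assms 1 by (simp add: m_def l_def wedge_def field_simps)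
    then have "orbit (lower_pair x y 0) = orbit (A_rep l m)"
      unfolding rep_lower_pair by (subst eq(1), subst eq(2), intro orbit_A)
        (use 1 in \<open>simp_all add: wedge_def\<close>)
    then show ?thesis using that(1) \<open>m \<noteq> 0\<close> by blast
  next
    case 2
    define l where "l = x$2 / x$1"
    have y2: "y$2 \<noteq> 0" using assms 2 by (auto simp: wedge_def)
    have eq: "x = x$1 *s vector [1, l]" "y = y$2 *s vector [0, 1]"
      using 2 by (simp_all add: vec_eq_iff forall_2 l_def)
    have "orbit (lower_pair x y 0) = orbit (A_inf2 l)"
      unfolding rep_lower_pair by (subst eq(1), subst eq(2), intro orbit_A)
        (use 2 y2 in \<open>simp_all add: wedge_def\<close>)
    then show ?thesis using that(2) by blast
  next
    case 3
    define l where "l = y$2 / y$1"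
    have nz: "x$2 \<noteq> 0" "y$1 \<noteq> 0" using assms 3 by (auto simp: wedge_def)
    have eq: "x = x$2 *s vector [0, 1]" "y = y$1 *s vector [1, l]"
      using 3 nz by (simp_all add: vec_eq_iff forall_2 l_def)
    have "orbit (lower_pair x y 0) = orbit (A_inf1 l)"
      unfolding rep_lower_pair by (subst eq(1), subst eq(2), intro orbit_A)
        (use nz in \<open>simp_all add: wedge_def\<close>)
    then show ?thesis using that(3) by blast
  qed
qed

lemma orbit_rank_one_scale:
  assumes "a \<noteq> 0"
  shows "orbit (lower_pair (a *s p) 0 0) = orbit (lower_pair p 0 0)"
  using orbit_lower_pair_rescale[of a 1 p 0 0 0 0] assms by simp

text \<open>Types B and E share the point \<open>p\<close> of the projective line as an index; both identifications are made at once so that the edge between them keeps its label.\<close>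

lemma orbit_B_named:
  assumes "p \<noteq> 0"
  obtains r l where "orbit (lower_pair p p z) = orbit (B_rep r l)"
      "orbit (lower_pair p 0 0) = orbit (E_rep r)"
    | l where "orbit (lower_pair p p z) = orbit (B_inf1 l)"
      "orbit (lower_pair p 0 0) = orbit E_inf"
proof (cases "p$1 = 0")
  case True
  then have p2: "p$2 \<noteq> 0" using assms by (simp add: vec_eq_iff forall_2)
  have eq: "p = p$2 *s vector [0, 1]" using True by (simp add: vec_eq_iff forall_2)
  have "orbit (lower_pair p p z) = orbit (B_inf1 (z$1 / (p$2 * p$2)))"
    unfolding rep_lower_pair by (subst eq, subst (2) eq, intro orbit_B)
      (use p2 in \<open>simp_all add: wedge_def vec_eq_iff forall_2\<close>)
  moreover have "orbit (lower_pair p 0 0) = orbit E_inf"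
    unfolding rep_lower_pair by (subst eq) (rule orbit_rank_one_scale[OF p2])
  ultimately show ?thesis using that(2) by blast
next
  case False
  define r where "r = p$2 / p$1"
  have eq: "p = p$1 *s vector [1, r]" using False by (simp add: vec_eq_iff forall_2 r_def)
  have "orbit (lower_pair p p z) = orbit (B_rep r (- wedge z (vector [1, r]) / (p$1 * p$1)))"
    unfolding rep_lower_pair by (subst eq, subst (2) eq, intro orbit_B)
      (use False in \<open>simp_all add: wedge_def vec_eq_iff forall_2\<close>)
  moreover have "orbit (lower_pair p 0 0) = orbit (E_rep r)"
    unfolding rep_lower_pair by (subst eq) (rule orbit_rank_one_scale[OF False])
  ultimately show ?thesis using that(1) by blast
qed

lemma E_orbits_eq:
  "(E_orbits :: 'k::field matrix_pair set set) = insert (orbit E_inf) (range (\<lambda>r. orbit (E_rep r)))"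
proof
  show "(E_orbits :: 'k matrix_pair set set) \<subseteq> insert (orbit E_inf) (range (\<lambda>r. orbit (E_rep r)))"
  proof
    fix e :: "'k matrix_pair set" assume "e \<in> E_orbits"
    then obtain p where p: "p \<noteq> 0" "e = orbit (lower_pair p 0 0)" unfolding E_orbits_def by blast
    show "e \<in> insert (orbit E_inf) (range (\<lambda>r. orbit (E_rep r)))"
      by (rule orbit_B_named[OF p(1), of 0]) (use p(2) in auto)
  qed
  have "vector [1, r] \<noteq> (0 :: 'k^2)" "vector [0, 1] \<noteq> (0 :: 'k^2)" for r
    by (simp_all add: vec_eq_iff forall_2)
  then show "insert (orbit E_inf) (range (\<lambda>r. orbit (E_rep r))) \<subseteq> (E_orbits :: 'k matrix_pair set set)"
    unfolding E_orbits_def rep_lower_pair by blast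
qed

text \<open>The listed edges in the coordinates \<open>x, y, z\<close>, where no case distinction between finite and
  infinite parameters remains.\<close>

lemma hasse_edge_lower_pair:
  "wedge x y \<noteq> 0 \<Longrightarrow> hasse_edge (orbit (lower_pair x y 0)) (orbit C_rep)"
  "wedge x y \<noteq> 0 \<Longrightarrow> hasse_edge (orbit (lower_pair x y 0)) (orbit D_rep)"
  "p \<noteq> 0 \<Longrightarrow> hasse_edge (orbit (lower_pair p p z)) (orbit (lower_pair p 0 0))"
  "e \<in> E_orbits \<Longrightarrow> hasse_edge (orbit C_rep) e"
  "e \<in> E_orbits \<Longrightarrow> hasse_edge (orbit D_rep) e"
  "e \<in> E_orbits \<Longrightarrow> hasse_edge e (orbit O_rep)"
proof -
  show "wedge x y \<noteq> 0 \<Longrightarrow> hasse_edge (orbit (lower_pair x y 0)) (orbit C_rep)"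
    by (erule orbit_A_named) (auto intro: hasse_edge.intros)
  show "wedge x y \<noteq> 0 \<Longrightarrow> hasse_edge (orbit (lower_pair x y 0)) (orbit D_rep)"
    by (erule orbit_A_named) (auto intro: hasse_edge.intros)
  show "p \<noteq> 0 \<Longrightarrow> hasse_edge (orbit (lower_pair p p z)) (orbit (lower_pair p 0 0))"
    by (erule orbit_B_named[of p z]) (auto intro: hasse_edge.intros)
qed (auto simp: E_orbits_eq intro: hasse_edge.intros)


section \<open>Minimal degenerations\<close>

text \<open>A pair \<open>Z\<close> between \<open>X\<close> and a member \<open>B\<close> of \<open>S\<close> has, by the second assumption, the orbit of
  \<open>X\<close> or of some member of \<open>S\<close>, which by the third one is the orbit of \<open>B\<close>; the remaining alternative
  is excluded because the pairs strictly under \<open>S\<close> are above no member of \<open>S\<close>.\<close>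

lemma minimal_degenerationsI:
  assumes below: "\<And>B. B \<in> S \<Longrightarrow> X \<le>deg B \<and> \<not> B \<le>deg X"
    and cover: "\<And>Y. X \<le>deg Y \<Longrightarrow> orbit Y = orbit X \<or>
      (\<exists>B\<in>S. orbit Y = orbit B \<or> (B \<le>deg Y \<and> (\<forall>B'\<in>S. \<not> Y \<le>deg B')))"
    and antichain: "\<And>B B'. B \<in> S \<Longrightarrow> B' \<in> S \<Longrightarrow> B \<le>deg B' \<Longrightarrow> orbit B = orbit B'"
  shows "minimal_degenerations X = orbit ` S"
proof -
  have "minimal_degeneration X B" if B: "B \<in> S" for B
    unfolding minimal_degeneration_def orbit_subset_closure_iff
  proof (intro conjI notI)
    show "orbit B = orbit X \<Longrightarrow> False" using below[OF B] deg_le_if_orbit_eq by blast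
    show "X \<le>deg B" using below[OF B] by blast
    assume "\<exists>Z. orbit Z \<noteq> orbit X \<and> orbit Z \<noteq> orbit B \<and> X \<le>deg Z \<and> Z \<le>deg B"
    then obtain Z where Z: "orbit Z \<noteq> orbit X" "orbit Z \<noteq> orbit B" "X \<le>deg Z" "Z \<le>deg B" by blast
    obtain B' where B': "B' \<in> S" "orbit Z = orbit B'" using cover[OF Z(3)] Z(1,4) B by blast
    then have "B' \<le>deg B" using Z(4) deg_le_cong by blast
    then show False using antichain[OF B'(1) B] B'(2) Z(2) by simp
  qed
  moreover have "orbit Y \<in> orbit ` S" if Y: "minimal_degeneration X Y" for Y
  proof (rule ccontr)
    assume no: "orbit Y \<notin> orbit ` S"
    have "orbit Y \<noteq> orbit X" "X \<le>deg Y"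
      using Y unfolding minimal_degeneration_def orbit_subset_closure_iff by blast+
    then obtain B where B: "B \<in> S" "B \<le>deg Y" using cover no by blast
    have "orbit B \<noteq> orbit X" using below[OF B(1)] deg_le_if_orbit_eq by blast
    moreover have "orbit B \<noteq> orbit Y" using no B(1) by (metis imageI)
    ultimately show False using Y B below[OF B(1)] unfolding minimal_degeneration_def by blast
  qed
  ultimately show ?thesis unfolding minimal_degenerations_def by blast
qed

lemma not_O_deg_le_rank_one:
  assumes "p \<noteq> 0"
  shows "\<not> O_rep \<le>deg lower_pair p 0 0"
proof
  assume le: "O_rep \<le>deg lower_pair p 0 0"
  have "p$1 = 0" "p$2 = 0"
    using nc_polynomial_zero_deg_le[OF nc_polynomial.intros(1) _ le]
      nc_polynomial_zero_deg_le[OF nc_polynomial.intros(2) _ le]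
    by (simp_all add: O_rep_def lower_pair_components strictly_lower_simps)
  then show False using assms by (simp add: vec_eq_iff forall_2)
qed

lemma not_rank_one_deg_le:
  "\<not> lower_pair p 0 0 \<le>deg C_rep" "\<not> lower_pair p 0 0 \<le>deg D_rep"
proof -
  have "\<not> lower_pair 0 p 0 \<le>deg C_rep"
    using D_deg_le[of p 0 "vector [1, 0]" 0 "vector [0, 1]"] by (auto simp: rep_lower_pair wedge_def)
  then show "\<not> lower_pair p 0 0 \<le>deg C_rep"
    using deg_le_cong[OF orbit_rank_one_corner refl] by blast
  show "\<not> lower_pair p 0 0 \<le>deg D_rep"
    using C_deg_le[of p 0 0 "vector [0, 1]" "vector [1, 0]"] by (auto simp: rep_lower_pair wedge_def)
qed

lemma C_D_incomparable:
  "\<not> C_rep \<le>deg D_rep" "\<not> D_rep \<le>deg C_rep"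
  using C_deg_le[of "vector [1, 0]" "vector [0, 1]" 0 "vector [0, 1]" "vector [1, 0]"]
    D_deg_le[of "vector [0, 1]" "vector [1, 0]" "vector [1, 0]" 0 "vector [0, 1]"]
  by (auto simp: rep_lower_pair wedge_def)

lemma not_deg_le_product_nonzero:
  assumes "x \<noteq> 0" "y \<noteq> 0"
  shows "\<not> C_rep \<le>deg lower_pair x y z" "\<not> D_rep \<le>deg lower_pair x y z"
    "\<not> lower_pair p 0 0 \<le>deg lower_pair x y z"
  using product_zero_deg_le assms unfolding rep_lower_pair by blast+

lemma strictly_below_CD:
  fixes Y :: "'k::alg_closed_field matrix_pair"
  assumes "orbit Y \<in> insert (orbit O_rep) E_orbits"
  shows "C_rep \<le>deg Y" "D_rep \<le>deg Y" "\<not> Y \<le>deg C_rep" "\<not> Y \<le>deg D_rep"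
proof -
  obtain p :: "'k^2" where p: "p \<noteq> 0" "lower_pair p 0 0 \<le>deg Y"
  proof (cases "orbit Y = orbit O_rep")
    case True
    have "axis 1 1 \<noteq> (0 :: 'k^2)" by (simp add: axis_eq_0_iff)
    then show thesis using that rank_one_deg_le_O deg_le_cong[OF refl True] by blast
  next
    case False
    then obtain p where "p \<noteq> 0" "orbit (lower_pair p 0 0) = orbit Y"
      using assms unfolding E_orbits_def by auto
    then show thesis using that deg_le_if_orbit_eq by blast
  qed
  then show "C_rep \<le>deg Y" "D_rep \<le>deg Y"
    using C_deg_le_rank_one D_deg_le_rank_one deg_le_trans by blast+
  show "\<not> Y \<le>deg C_rep" "\<not> Y \<le>deg D_rep"
    using p(2) not_rank_one_deg_le deg_le_trans by blast+
qed

lemma minimal_degenerations_A: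
  fixes x y :: "'k::alg_closed_field^2"
  assumes "wedge x y \<noteq> 0"
  shows "minimal_degenerations (lower_pair x y 0) = {orbit C_rep, orbit D_rep}"
proof -
  have nz: "x \<noteq> 0" "y \<noteq> 0" using assms by auto
  have "minimal_degenerations (lower_pair x y 0) = orbit ` {C_rep, D_rep}"
  proof (rule minimal_degenerationsI)
    show "lower_pair x y 0 \<le>deg B \<and> \<not> B \<le>deg lower_pair x y 0" if "B \<in> {C_rep, D_rep}" for B
      using that A_deg_le_C[OF assms] A_deg_le_D[OF assms] not_deg_le_product_nonzero[OF nz] by auto
    show "orbit Y = orbit (lower_pair x y 0) \<or> (\<exists>B\<in>{C_rep, D_rep}. orbit Y = orbit B \<or>
        (B \<le>deg Y \<and> (\<forall>B'\<in>{C_rep, D_rep}. \<not> Y \<le>deg B')))" if "lower_pair x y 0 \<le>deg Y" for Y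
      using degenerations_A[OF assms that] strictly_below_CD[of Y] by auto
  qed (use C_D_incomparable in auto)
  then show ?thesis by simp
qed

lemma O_not_above:
  assumes "p \<noteq> 0" "orbit Y = orbit O_rep"
  shows "\<not> Y \<le>deg lower_pair p 0 0"
  using not_O_deg_le_rank_one[OF assms(1)] deg_le_cong[OF assms(2) refl] by blast

lemma minimal_degenerations_B:
  fixes p z :: "'k::alg_closed_field^2"
  assumes "p \<noteq> 0"
  shows "minimal_degenerations (lower_pair p p z) = {orbit (lower_pair p 0 0)}"
proof -
  have "minimal_degenerations (lower_pair p p z) = orbit ` {lower_pair p 0 0}"
  proof (rule minimal_degenerationsI)
    show "lower_pair p p z \<le>deg B \<and> \<not> B \<le>deg lower_pair p p z" if "B \<in> {lower_pair p 0 0}" for B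
      using that B_deg_le_rank_one[OF assms] not_deg_le_product_nonzero(3)[OF assms assms] by blast
    fix Y assume "lower_pair p p z \<le>deg Y"
    then consider "orbit Y = orbit (lower_pair p p z)" | "orbit Y = orbit (lower_pair p 0 0)"
      | "orbit Y = orbit O_rep"
      using degenerations_B[OF assms] by blast
    then show "orbit Y = orbit (lower_pair p p z) \<or> (\<exists>B\<in>{lower_pair p 0 0}. orbit Y = orbit B \<or>
        (B \<le>deg Y \<and> (\<forall>B'\<in>{lower_pair p 0 0}. \<not> Y \<le>deg B')))"
    proof cases
      case 3
      then have "lower_pair p 0 0 \<le>deg Y" using rank_one_deg_le_O deg_le_cong[OF refl 3] by blast
      then show ?thesis using O_not_above[OF assms 3] by simp
    qed simp_all
  qed simp
  then show ?thesis by simp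
qed

lemma minimal_degenerations_rank_one:
  fixes p :: "'k::alg_closed_field^2"
  assumes "p \<noteq> 0"
  shows "minimal_degenerations (lower_pair p 0 0) = {orbit O_rep}"
proof -
  have "minimal_degenerations (lower_pair p 0 0) = orbit ` {O_rep}"
  proof (rule minimal_degenerationsI)
    show "lower_pair p 0 0 \<le>deg B \<and> \<not> B \<le>deg lower_pair p 0 0" if "B \<in> {O_rep}" for B
      using that rank_one_deg_le_O not_O_deg_le_rank_one[OF assms] by blast
  qed (use degenerations_rank_one[OF assms] in blast)+
  then show ?thesis by simp
qed

lemma rank_one_antichain:
  assumes "p \<noteq> 0" "q \<noteq> 0" "lower_pair p 0 0 \<le>deg lower_pair q 0 0"
  shows "orbit (lower_pair p 0 0) = orbit (lower_pair q 0 0)"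
proof -
  have "orbit (lower_pair q 0 0) \<noteq> orbit O_rep" using O_not_above[OF assms(2)] deg_le_refl by blast
  then show ?thesis using degenerations_rank_one[OF assms(1,3)] by (metis insertE singletonD)
qed

text \<open>C and D degenerate to all orbits of type E at once, and these are pairwise incomparable
  because \<open>p\<close> is determined up to scaling.\<close>

lemma minimal_degenerations_CD:
  fixes X :: "'k::alg_closed_field matrix_pair"
  assumes X: "X = C_rep \<or> X = D_rep"
  shows "minimal_degenerations X = E_orbits"
proof -
  have le: "X \<le>deg lower_pair p 0 0" "\<not> lower_pair p 0 0 \<le>deg X" if "p \<noteq> 0" for p
    using X C_deg_le_rank_one[OF that] D_deg_le_rank_one[OF that] not_rank_one_deg_le by blast+
  let ?S = "{lower_pair p 0 0 | p :: 'k^2. p \<noteq> 0}"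
  have "minimal_degenerations X = orbit ` ?S"
  proof (rule minimal_degenerationsI)
    fix Y assume "X \<le>deg Y"
    then have Y: "orbit Y \<in> {orbit X, orbit O_rep} \<union> E_orbits"
      using X degenerations_C degenerations_D by blast
    then consider "orbit Y = orbit X" | p where "p \<noteq> 0" "orbit Y = orbit (lower_pair p 0 0)"
      | "orbit Y = orbit O_rep"
      unfolding E_orbits_def by blast
    then show "orbit Y = orbit X \<or> (\<exists>B\<in>?S. orbit Y = orbit B \<or>
        (B \<le>deg Y \<and> (\<forall>B'\<in>?S. \<not> Y \<le>deg B')))"
    proof cases
      case 2
      then show ?thesis by blast
    next
      case 3
      have "axis 1 1 \<noteq> (0 :: 'k^2)" by (simp add: axis_eq_0_iff)
      then have "lower_pair (axis 1 1) 0 0 \<in> ?S" by blast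
      moreover have "lower_pair (axis 1 1) 0 0 \<le>deg Y"
        using rank_one_deg_le_O deg_le_cong[OF refl 3] by blast
      moreover have "\<forall>B'\<in>?S. \<not> Y \<le>deg B'" using O_not_above[OF _ 3] by auto
      ultimately show ?thesis by blast
    qed simp
  qed (use le rank_one_antichain in blast)+
  also have "orbit ` ?S = E_orbits" by (simp only: E_orbits_def setcompr_eq_image image_image)
  finally show ?thesis .
qed

lemma minimal_degenerations_O: "minimal_degenerations O_rep = {}"
proof -
  have "\<not> minimal_degeneration O_rep Y" for Y
    unfolding minimal_degeneration_def orbit_subset_closure_iff using degenerations_O[of Y] by blast
  then show ?thesis unfolding minimal_degenerations_def by blast
qed

text \<open>Only the orbits of the two pairs matter, so a representative may replace the first one.\<close>

lemma minimal_degeneration_cong: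
  assumes "orbit X = orbit R"
  shows "minimal_degeneration X Y \<longleftrightarrow> orbit Y \<in> minimal_degenerations R"
proof -
  have "minimal_degeneration X Y \<longleftrightarrow> minimal_degeneration R Y'" if "orbit Y' = orbit Y" for Y'
  proof -
    have "X \<le>deg Z \<longleftrightarrow> R \<le>deg Z" "Z \<le>deg Y \<longleftrightarrow> Z \<le>deg Y'" for Z
      using deg_le_cong[OF assms refl] deg_le_cong[OF refl that] by blast+
    then show ?thesis unfolding minimal_degeneration_def orbit_subset_closure_iff assms that by simp
  qed
  note indep = this
  show ?thesis
  proof
    assume "minimal_degeneration X Y"
    then show "orbit Y \<in> minimal_degenerations R"
      using indep[OF refl] unfolding minimal_degenerations_def by blast
  next
    assume "orbit Y \<in> minimal_degenerations R"
    then obtain Y' where "orbit Y' = orbit Y" "minimal_degeneration R Y'"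
      unfolding minimal_degenerations_def by force
    then show "minimal_degeneration X Y" using indep by blast
  qed
qed

lemma nilpotent_pair_orbit:
  assumes "X \<in> nilpotent_pairs"
  shows "\<exists>x y z. orbit X = orbit (lower_pair x y z)"
proof (rule orbit_lower_pair_if_words_vanish)
  have "{fst X, snd X} \<subseteq> subalgebra hull {fst X, snd X}" by (rule hull_subset)
  moreover have "nilpotent_algebra (subalgebra hull {fst X, snd X})"
    using assms unfolding nilpotent_pairs_def by (simp add: case_prod_beta)
  ultimately show "\<exists>n. \<forall>ws. length ws = n \<and> set ws \<subseteq> {fst X, snd X} \<longrightarrow> foldr (**) ws (mat 1) = 0"
    unfolding nilpotent_algebra_def by (meson subset_trans)
qed

lemma minimal_degenerations_named:
  fixes l m r :: "'k::alg_closed_field"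
  shows "m \<noteq> 0 \<Longrightarrow> minimal_degenerations (A_rep l m) = {orbit C_rep, orbit D_rep}"
    "minimal_degenerations (A_inf2 l) = {orbit C_rep, orbit D_rep}"
    "minimal_degenerations (A_inf1 l) = {orbit C_rep, orbit D_rep}"
    "minimal_degenerations (B_rep r l) = {orbit (E_rep r)}"
    "minimal_degenerations (B_inf1 l) = {orbit E_inf}"
    "minimal_degenerations (C_rep :: 'k matrix_pair) = insert (orbit E_inf) (range (\<lambda>r. orbit (E_rep r)))"
    "minimal_degenerations (D_rep :: 'k matrix_pair) = insert (orbit E_inf) (range (\<lambda>r. orbit (E_rep r)))"
    "minimal_degenerations (E_rep r) = {orbit O_rep}"
    "minimal_degenerations (E_inf :: 'k matrix_pair) = {orbit O_rep}"
proof -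
  have nz: "vector [1, s] \<noteq> (0 :: 'k^2)" "vector [0, 1] \<noteq> (0 :: 'k^2)" for s
    by (simp_all add: vec_eq_iff forall_2)
  show "minimal_degenerations (A_rep l m) = {orbit C_rep, orbit D_rep}" if "m \<noteq> 0"
    unfolding rep_lower_pair(1) using that by (intro minimal_degenerations_A) (simp add: wedge_def)
  show "minimal_degenerations (A_inf2 l) = {orbit C_rep, orbit D_rep}"
    unfolding rep_lower_pair(2) by (intro minimal_degenerations_A) (simp add: wedge_def)
  show "minimal_degenerations (A_inf1 l) = {orbit C_rep, orbit D_rep}"
    unfolding rep_lower_pair(3) by (intro minimal_degenerations_A) (simp add: wedge_def)
  show "minimal_degenerations (B_rep r l) = {orbit (E_rep r)}"
    "minimal_degenerations (B_inf1 l) = {orbit E_inf}"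
    unfolding rep_lower_pair(4,5,8,9) using minimal_degenerations_B nz by blast+
  show "minimal_degenerations (E_rep r) = {orbit O_rep}"
    "minimal_degenerations (E_inf :: 'k matrix_pair) = {orbit O_rep}"
    unfolding rep_lower_pair(8,9) using minimal_degenerations_rank_one nz by blast+
  show "minimal_degenerations (C_rep :: 'k matrix_pair) =
      insert (orbit E_inf) (range (\<lambda>r. orbit (E_rep r)))"
    "minimal_degenerations (D_rep :: 'k matrix_pair) =
      insert (orbit E_inf) (range (\<lambda>r. orbit (E_rep r)))"
    unfolding E_orbits_eq[symmetric] by (rule minimal_degenerations_CD, simp)+
qed

lemma hasse_edge_minimal:
  fixes X Y :: "'k::alg_closed_field matrix_pair"
  assumes "hasse_edge (orbit X) (orbit Y)"
  shows "minimal_degeneration X Y"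
proof -
  have "\<exists>R. a = orbit R \<and> b \<in> minimal_degenerations R" if "hasse_edge a b"
    for a b :: "'k matrix_pair set"
    using that
    by induction (rule exI, rule conjI, rule refl, simp add: minimal_degenerations_named)+
  then show ?thesis using assms minimal_degeneration_cong by blast
qed

lemma minimal_hasse_edge:
  fixes X Y :: "'k::alg_closed_field matrix_pair"
  assumes "X \<in> nilpotent_pairs" "minimal_degeneration X Y"
  shows "hasse_edge (orbit X) (orbit Y)"
proof -
  have Y: "orbit Y \<in> minimal_degenerations R" if "orbit X = orbit R" for R
    using minimal_degeneration_cong[OF that, of Y] assms(2) by simp
  obtain x y z where X: "orbit X = orbit (lower_pair x y z)" using nilpotent_pair_orbit[OF assms(1)] by blast
  show ?thesis
  proof (cases rule: orbit_classification[of x y z])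
    case (A x' y')
    have "orbit Y \<in> {orbit C_rep, orbit D_rep}"
      using Y[of "lower_pair x' y' 0"] minimal_degenerations_A[OF A(1)] A(2) X by simp
    then show ?thesis unfolding X A(2) using hasse_edge_lower_pair(1,2)[OF A(1)] by auto
  next
    case (B p z')
    have "orbit Y = orbit (lower_pair p 0 0)"
      using Y[of "lower_pair p p z'"] minimal_degenerations_B[OF B(1)] B(2) X by simp
    then show ?thesis unfolding X B(2) using hasse_edge_lower_pair(3)[OF B(1)] by simp
  next
    case C
    have "orbit Y \<in> E_orbits" using Y[of C_rep] C X by (simp add: minimal_degenerations_CD)
    then show ?thesis unfolding X C by (rule hasse_edge_lower_pair(4))
  next
    case D
    have "orbit Y \<in> E_orbits" using Y[of D_rep] D X by (simp add: minimal_degenerations_CD)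
    then show ?thesis unfolding X D by (rule hasse_edge_lower_pair(5))
  next
    case (E p)
    have "orbit (lower_pair p 0 0) \<in> E_orbits" using E(1) unfolding E_orbits_def by blast
    moreover have "orbit Y = orbit O_rep"
      using Y[of "lower_pair p 0 0"] minimal_degenerations_rank_one[OF E(1)] E(2) X by simp
    ultimately show ?thesis unfolding X E(2) using hasse_edge_lower_pair(6) by simp
  next
    case O
    then show ?thesis using Y[of O_rep] X by (simp add: minimal_degenerations_O)
  qed
qed

lemma E_orbits_path:
  assumes "e \<in> insert (orbit O_rep) E_orbits"
  shows "hasse_edge\<^sup>*\<^sup>* (orbit C_rep) e" "hasse_edge\<^sup>*\<^sup>* (orbit D_rep) e"
proof -
  obtain e' where e': "e' \<in> E_orbits" "hasse_edge\<^sup>*\<^sup>* e' e"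
  proof (cases "e = orbit O_rep")
    case True
    have E_inf: "orbit E_inf \<in> E_orbits" unfolding E_orbits_eq by simp
    show thesis using that[OF E_inf] hasse_edge_lower_pair(6)[OF E_inf] True by blast
  next
    case False
    then show thesis using that assms by blast
  qed
  show "hasse_edge\<^sup>*\<^sup>* (orbit C_rep) e" "hasse_edge\<^sup>*\<^sup>* (orbit D_rep) e"
    using hasse_edge_lower_pair(4,5)[OF e'(1)] e'(2) by (simp_all add: converse_rtranclp_into_rtranclp)
qed

lemma deg_le_path:
  fixes X Y :: "'k::alg_closed_field matrix_pair"
  assumes "X \<in> nilpotent_pairs" "X \<le>deg Y"
  shows "hasse_edge\<^sup>*\<^sup>* (orbit X) (orbit Y)"
proof -
  have Y: "R \<le>deg Y" if "orbit X = orbit R" for R using deg_le_cong[OF that refl] assms(2) by blast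
  obtain x y z where X: "orbit X = orbit (lower_pair x y z)"
    using nilpotent_pair_orbit[OF assms(1)] by blast
  show ?thesis
  proof (cases rule: orbit_classification[of x y z])
    case (A x' y')
    consider "orbit Y = orbit X" | "orbit Y = orbit C_rep" | "orbit Y = orbit D_rep"
      | "orbit Y \<in> insert (orbit O_rep) E_orbits"
      using degenerations_A[OF A(1) Y] A(2) X by auto
    then show ?thesis
    proof cases
      case 4
      show ?thesis
        unfolding X A(2) using hasse_edge_lower_pair(1)[OF A(1)] E_orbits_path(1)[OF 4]
        by (rule converse_rtranclp_into_rtranclp)
    qed (use hasse_edge_lower_pair(1,2)[OF A(1)] A(2) X in auto)
  next
    case (B p z')
    have p: "orbit (lower_pair p 0 0) \<in> E_orbits" using B(1) unfolding E_orbits_def by blast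
    consider "orbit Y = orbit X" | "orbit Y = orbit (lower_pair p 0 0)" | "orbit Y = orbit O_rep"
      using degenerations_B[OF B(1) Y] B(2) X by auto
    then show ?thesis
    proof cases
      case 3
      show ?thesis
        unfolding X B(2) 3 using hasse_edge_lower_pair(3)[OF B(1)] hasse_edge_lower_pair(6)[OF p]
        by (rule converse_rtranclp_into_rtranclp[OF _ r_into_rtranclp])
    qed (use hasse_edge_lower_pair(3)[OF B(1)] B(2) X in auto)
  next
    case C
    then show ?thesis
      using degenerations_C[OF Y] E_orbits_path(1)[of "orbit Y"] X by auto
  next
    case D
    then show ?thesis
      using degenerations_D[OF Y] E_orbits_path(2)[of "orbit Y"] X by auto
  next
    case (E p)
    have p: "orbit (lower_pair p 0 0) \<in> E_orbits" using E(1) unfolding E_orbits_def by blast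
    show ?thesis
      using degenerations_rank_one[OF E(1) Y] E(2) X hasse_edge_lower_pair(6)[OF p] by auto
  next
    case O
    then show ?thesis using degenerations_O[OF Y] X by simp
  qed
qed

lemma path_deg_le:
  fixes X Y :: "'k::alg_closed_field matrix_pair"
  assumes "hasse_edge\<^sup>*\<^sup>* (orbit X) (orbit Y)"
  shows "X \<le>deg Y"
proof -
  have "\<exists>Z. e = orbit Z \<and> X \<le>deg Z" if "hasse_edge\<^sup>*\<^sup>* (orbit X) e" for e
    using that
  proof induction
    case base
    then show ?case using deg_le_refl by blast
  next
    case (step e e')
    then obtain Z where Z: "e = orbit Z" "X \<le>deg Z" by blast
    have "\<exists>Z'. e' = orbit Z'" using step(2) by cases blast+
    then obtain Z' where Z': "e' = orbit Z'" by blast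
    have "minimal_degeneration Z Z'" using hasse_edge_minimal[OF step(2)[unfolded Z(1) Z']] .
    then have "Z \<le>deg Z'" unfolding minimal_degeneration_def orbit_subset_closure_iff by simp
    then show ?case using Z' deg_le_trans[OF Z(2)] by blast
  qed
  then show ?thesis using assms deg_le_cong by blast
qed

theorem proposition4p3:
  shows
    "(\<forall>l m :: 'k::alg_closed_field. m \<noteq> 0 \<longrightarrow>
        minimal_degenerations (A_rep l m) = {orbit C_rep, orbit D_rep}) \<and>
     (\<forall>l :: 'k. minimal_degenerations (A_inf2 l) = {orbit C_rep, orbit D_rep}) \<and>
     (\<forall>l :: 'k. minimal_degenerations (A_inf1 l) = {orbit C_rep, orbit D_rep}) \<and>
     (\<forall>r l :: 'k. minimal_degenerations (B_rep r l) = {orbit (E_rep r)}) \<and>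
     (\<forall>l :: 'k. minimal_degenerations (B_inf1 l) = {orbit E_inf}) \<and>
     minimal_degenerations (C_rep :: 'k matrix_pair) =
       insert (orbit E_inf) (range (\<lambda>r. orbit (E_rep r))) \<and>
     minimal_degenerations (D_rep :: 'k matrix_pair) =
       insert (orbit E_inf) (range (\<lambda>r. orbit (E_rep r))) \<and>
     (\<forall>r :: 'k. minimal_degenerations (E_rep r) = {orbit O_rep}) \<and>
     minimal_degenerations (E_inf :: 'k matrix_pair) = {orbit O_rep} \<and>
     (\<forall>Y :: 'k matrix_pair. O_rep \<le>deg Y \<longrightarrow> orbit Y = orbit O_rep) \<and>
     (\<forall>X \<in> nilpotent_pairs. \<forall>Y \<in> nilpotent_pairs :: 'k matrix_pair set.
        minimal_degeneration X Y \<longleftrightarrow> hasse_edge (orbit X) (orbit Y)) \<and>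
     (\<forall>X \<in> nilpotent_pairs. \<forall>Y \<in> nilpotent_pairs :: 'k matrix_pair set.
        X \<le>deg Y \<longleftrightarrow> hasse_edge\<^sup>*\<^sup>* (orbit X) (orbit Y))"
proof (intro conjI allI impI ballI)
  fix X Y :: "'k matrix_pair"
  assume X: "X \<in> nilpotent_pairs"
  show "minimal_degeneration X Y \<longleftrightarrow> hasse_edge (orbit X) (orbit Y)"
    using minimal_hasse_edge[OF X] hasse_edge_minimal by blast
  show "X \<le>deg Y \<longleftrightarrow> hasse_edge\<^sup>*\<^sup>* (orbit X) (orbit Y)"
    using deg_le_path[OF X] path_deg_le by blast
qed (simp_all only: minimal_degenerations_named degenerations_O simp_thms)

end
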